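(* Let $X=(X_t)_{t\in[0,\infty)}$ together with a random time $\sigma$ and $Y=(Y_t)_{t\in[0,\infty)}$ together with a random time $\tau$ be measurable processes valued in measurable spaces $E$ and $F$ respectively, $(X,\sigma)$ being independent of $(Y,\tau)$. Suppose further that $H:E\times F\to\mathbb{R}$ is bounded measurable, and let $\phi:E\times F\to\mathbb{R}$ be a measurable map such that either with the sign $+$ (for all $T$) or with the sign $-$ (for all $T$) in place of $\pm$ (not necessarily both) $$\int_0^T\int_0^T\mathbb{E}[\phi_\pm(X_{s\wedge\sigma},Y_{t\wedge\tau})]\mathbf{1}_{[0,T]}(s+t)\,\mathrm{d}s\,\mathrm{d}t<\infty,\qquad T\in[0,\infty),$$ such that $$\mathbb{E}[|\phi(X_\sigma,Y_\tau)|;\sigma+\tau\le t]<\infty\quad\text{for a.e. }t\in[0,\infty),$$ and such that $$\Big(H(X_{t\wedge\sigma},y)-\int_0^{t\wedge\sigma}\phi(X_s,y)\,\mathrm{d}s\Big)_{t\in[0,\infty)}\ \text{is a martingale for all }y\in F,$$ while $$\Big(H(x,Y_{t\wedge\tau})-\int_0^{t\wedge\tau}\phi(x,Y_s)\,\mathrm{d}s\Big)_{t\in[0,\infty)}\ \text{is a martingale for all }x\in E,$$ where the Lebesgue integrals in the last two displays are assumed to be well-defined and finite a.s. Then, for a.e. $t\in[0,\infty)$, \begin{align*} \mathbb{E}[H(X_{t\wedge\sigma},Y_0)]-\mathbb{E}[H(X_0,Y_{t\wedge\tau})]&=\mathbb{E}[H(X_{(t-\tau)\wedge\sigma},Y_\tau)-H(X_0,Y_\tau);\tau\le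 t]\\ &\quad-\mathbb{E}[H(X_\sigma,Y_{(t-\sigma)\wedge\tau})-H(X_\sigma,Y_0);\sigma\le t]\\ &\quad+\mathbb{E}\Big[\phi(X_\sigma,Y_\tau)\big(((t-\tau)_+-\sigma)_+-((t-\sigma)_+-\tau)_+\big)\Big], \end{align*} all the expectations being absolutely convergent. In particular, if $\sigma\equiv\infty\equiv\tau$, then this becomes $$\mathbb{E}[H(X_t,Y_0)]=\mathbb{E}[H(X_0,Y_t)]\quad\text{for a.e. }t\in[0,\infty).$$
   Context: Random times are $[0,\infty]$-valued random variables. $\mathbb{E}[Z;A]=\mathbb{E}[Z\mathbf{1}_A]$; $r_+=\max(r,0)$; $\phi_+=\max(\phi,0)$, $\phi_-=\max(-\phi,0)$; "a.e." refers to Lebesgue measure. Integrands are understood to be $0$ where the accompanying indicator or nonnegative factor vanishes (so $X_\sigma$, $Y_\tau$ matter only where $\sigma<\infty$, $\tau<\infty$). Everything is defined on one probability space with expectation $\mathbb{E}$.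
   Formalization: Independence of (X,σ) and (Y,τ) is required to include the stopped values X_{t∧σ} and Y_{t∧τ}, not only all X_t, σ and Y_t, τ; with coordinates alone the claim fails (X_t=Z1{t=σ}, Y_t=Z, τ=∞, H=xy, φ=0). *)

theory Defs
  imports "HOL-Probability.Probability"
begin

definition measurable_process :: "'w measure \<Rightarrow> 'e measure \<Rightarrow> (real \<Rightarrow> 'w \<Rightarrow> 'e) \<Rightarrow> bool" where
  "measurable_process M E X \<longleftrightarrow>
     (\<lambda>(t, \<omega>). X t \<omega>) \<in> (restrict_space borel {0..} \<Otimes>\<^sub>M M) \<rightarrow>\<^sub>M E"

text \<open>The minimum of two times in \<open>[0, \<infinity>]\<close>, as a real number. It is only meaningful when at
  least one of them is finite, which is the case in all uses.\<close>

definition tmin :: "ennreal \<Rightarrow> ennreal \<Rightarrow> real" where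
  "tmin a b = enn2real (min a b)"

text \<open>Independence of random elements with values in possibly different types; the library's
  \<open>prob_space.indep_var\<close> requires both value spaces to have the same type.\<close>

definition indep_elements ::
  "'w measure \<Rightarrow> 'a measure \<Rightarrow> ('w \<Rightarrow> 'a) \<Rightarrow> 'b measure \<Rightarrow> ('w \<Rightarrow> 'b) \<Rightarrow> bool" where
  "indep_elements M S A T B \<longleftrightarrow>
     A \<in> M \<rightarrow>\<^sub>M S \<and> B \<in> M \<rightarrow>\<^sub>M T \<and>
     prob_space.indep_set M
       {A -` C \<inter> space M | C. C \<in> sets S}
       {B -` C \<inter> space M | C. C \<in> sets T}"

text \<open>The information carried by a process \<open>X\<close> together with a random time \<open>\<sigma>\<close>: the values
  \<open>X\<^sub>t\<close>, the values of the stopped process \<open>X\<^bsub>t \<and> \<sigma>\<^esub>\<close>, and \<open>\<sigma>\<close> itself.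

  The stopped values must be listed: on the product \<open>\<sigma>\<close>-algebra of path space they are in general
  not a function of the path and of \<open>\<sigma>\<close>, even for jointly measurable \<open>X\<close>. For instance, let \<open>\<sigma>\<close>
  have an atomless law and let \<open>X\<^sub>t = Z\<close> if \<open>t = \<sigma>\<close> and \<open>X\<^sub>t = 0\<close> otherwise, with \<open>Z\<close> a random sign
  independent of \<open>\<sigma>\<close>. Up to null events all the \<open>X\<^sub>t\<close> together with \<open>\<sigma>\<close> only generate the
  \<open>\<sigma>\<close>-algebra of \<open>\<sigma>\<close>, although \<open>X\<^sub>\<sigma> = Z\<close>. If \<open>X\<close> is measurable with respect to the product of the
  Borel sets of \<open>[0, \<infinity>)\<close> and the \<open>\<sigma>\<close>-algebra generated by \<open>X\<close> and \<open>\<sigma>\<close> (as when it has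
  right-continuous paths in a metric space), then the stopped values add nothing.\<close>

definition path_space ::
  "'e measure \<Rightarrow> ((real \<Rightarrow> 'e) \<times> (real \<Rightarrow> 'e) \<times> ennreal) measure" where
  "path_space E = (\<Pi>\<^sub>M t\<in>{0..}. E) \<Otimes>\<^sub>M ((\<Pi>\<^sub>M t\<in>{0..}. E) \<Otimes>\<^sub>M borel)"

definition path_with_time ::
  "(real \<Rightarrow> 'w \<Rightarrow> 'e) \<Rightarrow> ('w \<Rightarrow> ennreal) \<Rightarrow> 'w \<Rightarrow> (real \<Rightarrow> 'e) \<times> (real \<Rightarrow> 'e) \<times> ennreal" where
  "path_with_time X \<sigma> \<omega> =
     ((\<lambda>t\<in>{0..}. X t \<omega>), (\<lambda>t\<in>{0..}. X (tmin (ennreal t) (\<sigma> \<omega>)) \<omega>), \<sigma> \<omega>)"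

definition martingale_wrt ::
  "'w measure \<Rightarrow> (real \<Rightarrow> 'w measure) \<Rightarrow> (real \<Rightarrow> 'w \<Rightarrow> real) \<Rightarrow> bool" where
  "martingale_wrt M \<F> Z \<longleftrightarrow>
     (\<forall>t\<ge>0. subalgebra M (\<F> t)) \<and>
     (\<forall>s t. 0 \<le> s \<and> s \<le> t \<longrightarrow> sets (\<F> s) \<subseteq> sets (\<F> t)) \<and>
     (\<forall>t\<ge>0. Z t \<in> borel_measurable (\<F> t)) \<and>
     (\<forall>t\<ge>0. integrable M (Z t)) \<and>
     (\<forall>s t. 0 \<le> s \<and> s \<le> t \<longrightarrow> (AE \<omega> in M. real_cond_exp M (\<F> s) (Z t) \<omega> = Z s \<omega>))"

text \<open>When no filtration is mentioned, some filtration may be used. By the tower property this is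
  the same as being a martingale with respect to the natural filtration.\<close>

definition martingale :: "'w measure \<Rightarrow> (real \<Rightarrow> 'w \<Rightarrow> real) \<Rightarrow> bool" where
  "martingale M Z \<longleftrightarrow> (\<exists>\<F>. martingale_wrt M \<F> Z)"

text \<open>In the statements using these definitions, times \<open>t \<ge> 0\<close> are reals, random times have type
  \<open>ennreal\<close>, and subtraction on \<open>ennreal\<close> is truncated: \<open>a - b\<close> is \<open>(a - b)\<^sub>+\<close>, in particular
  \<open>ennreal t - \<infinity> = 0\<close>. A value such as \<open>X (enn2real (\<sigma> \<omega>)) \<omega>\<close> is \<open>X\<^sub>\<sigma>\<close> where \<open>\<sigma> < \<infinity>\<close>; elsewhere it
  is always multiplied by zero.\<close>

end

theory Submission
  imports Defs
begin

text \<open>Write \<open>x\<^sub>s = X\<^bsub>s \<and> \<sigma>\<^esub>\<close>, \<open>y\<^sub>t = Y\<^bsub>t \<and> \<tau>\<^esub>\<close> and \<open>m(s,t) = E[H(x\<^sub>s, y\<^sub>t)]\<close>. Fix a horizon \<open>K\<close> and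
  consider two independent copies \<open>\<omega>, \<omega>'\<close> of the sample point. The proof computes in two ways the
  integral over \<open>s, t, \<omega>, \<omega>'\<close> of
  \<open>f = \<phi>(x\<^sub>s(\<omega>), y\<^sub>t(\<omega>'))\<close> on \<open>{0 \<le> s \<le> \<sigma>(\<omega>), 0 \<le> t \<le> \<tau>(\<omega>'), s + t \<le> K}\<close>, with \<open>f = 0\<close> elsewhere.
  Integrating first over \<open>s\<close> and \<open>\<omega>\<close>, the martingale property of \<open>X\<close> with \<open>y = y\<^sub>t(\<omega>')\<close> frozen turns the
  inner integral into \<open>E[H(x\<^bsub>K-t\<^esub>, y)] - E[H(x\<^sub>0, y)]\<close> on \<open>{t \<le> \<tau>, t \<le> K}\<close>. Splitting the
  indicator of \<open>{t \<le> \<tau>}\<close> as one minus that of \<open>{\<tau> < t}\<close> and recombining the copies by independence, the integral of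
  \<open>f\<close> becomes
  \<open>\<integral> m(K-t, t) dt - \<integral> m(0, t) dt - \<integral> c\<^sub>X(t) dt\<close> over \<open>t \<in> [0, K]\<close>,
  where \<open>c\<^sub>X(t) = E[H(x\<^bsub>t-\<tau>\<^esub>, Y\<^sub>\<tau>) - H(x\<^sub>0, Y\<^sub>\<tau>); \<tau> \<le> t]\<close>; the last term arises from the substitution
  \<open>t \<mapsto> K + \<tau> - t\<close> (lemma \<open>integral_duality_integrand\<close>). Integrating first over \<open>t\<close> and \<open>\<omega>'\<close> gives the
  same expression with the roles of \<open>X\<close> and \<open>Y\<close> exchanged. The integrals of \<open>m\<close> along the antidiagonal
  cancel, so that \<open>m(t,0) - m(0,t) - c\<^sub>X(t) + c\<^sub>Y(t)\<close> has integral zero over \<open>[0, K]\<close> for every \<open>K\<close> and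
  therefore vanishes for almost every \<open>t\<close>. The remaining term of the identity is zero, since
  \<open>((t - \<tau>)\<^sub>+ - \<sigma>)\<^sub>+ = ((t - \<sigma>)\<^sub>+ - \<tau>)\<^sub>+\<close>.

  Two points need care. Only one of \<open>\<phi>\<^sub>+\<close>, \<open>\<phi>\<^sub>-\<close> is known to be integrable, but the inner integrals of
  \<open>f\<close> are bounded because \<open>H\<close> is, and this makes the other part integrable too (lemma
  \<open>Fubini_one_sided\<close>). And independence is available for \<open>x\<^sub>s\<close> and \<open>(y\<^sub>t, \<tau>)\<close> at fixed times only: the
  paths are jointly measurable in \<open>(t, \<omega>)\<close>, but this joint measurability does not refer to the
  \<open>\<sigma>\<close>-algebra of the path, so \<open>x\<^bsub>t-\<tau>\<^esub>\<close> need not decouple from \<open>\<tau>\<close> for a given \<open>t\<close>. Averaging over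
  \<open>t\<close> first removes the problem, at the price of an exceptional null set.\<close>

section \<open>Vanishing integrals over intervals\<close>

text \<open>The positive and the negative part of \<open>g\<close>, taken as densities, define finite measures that agree on
  half-lines and are therefore equal.\<close>

lemma AE_zero_if_Ioi_integrals_zero:
  fixes g :: "real \<Rightarrow> real"
  assumes g: "integrable lborel g"
    and zero: "\<And>a. (LINT x|lborel. indicator {a<..} x * g x) = 0"
  shows "AE x in lborel. g x = 0"
proof -
  have [measurable]: "g \<in> borel_measurable borel" using g by auto
  have gi: "integrable lborel (\<lambda>x. indicator {a<..} x * g x)" for a
    using integrable_real_mult_indicator[OF _ g, of "{a<..}"] by (simp add: mult.commute)
  have P: "emeasure (density lborel (\<lambda>x. ennreal (h x))) {a<..} = (\<integral>\<^sup>+x. ennreal (indicator {a<..} x * h x) \<partial>lborel)"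
    if [measurable]: "h \<in> borel_measurable borel" for h :: "real \<Rightarrow> real" and a
    by (simp add: emeasure_density) (intro nn_integral_cong, auto split: split_indicator)
  have fin: "(\<integral>\<^sup>+x. ennreal (indicator {a<..} x * g x) \<partial>lborel) < \<infinity>" for a
    using gi[of a] by (auto simp: real_integrable_def less_top)
  have eq: "(\<integral>\<^sup>+x. ennreal (indicator {a<..} x * g x) \<partial>lborel) = (\<integral>\<^sup>+x. ennreal (indicator {a<..} x * - g x) \<partial>lborel)" for a
  proof -
    have *: "(\<integral>\<^sup>+x. ennreal (- (indicator {a<..} x * g x)) \<partial>lborel) < \<infinity>"
      using gi[of a] by (auto simp: real_integrable_def less_top)
    from zero[of a] have "enn2real (\<integral>\<^sup>+x. ennreal (indicator {a<..} x * g x) \<partial>lborel)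
       = enn2real (\<integral>\<^sup>+x. ennreal (- (indicator {a<..} x * g x)) \<partial>lborel)"
      by (subst (asm) real_lebesgue_integral_def[OF gi]) simp
    with fin[of a] * show ?thesis
      by (cases "\<integral>\<^sup>+x. ennreal (indicator {a<..} x * g x) \<partial>lborel";
          cases "\<integral>\<^sup>+x. ennreal (- (indicator {a<..} x * g x)) \<partial>lborel") auto
  qed
  have "density lborel (\<lambda>x. ennreal (g x)) = density lborel (\<lambda>x. ennreal (- g x))"
    by (rule measure_eqI_lessThan) (use fin eq in \<open>simp_all add: P\<close>)
  then have "AE x in lborel. ennreal (g x) = ennreal (- g x)"
    by (intro sigma_finite_measure.density_unique[OF sigma_finite_lborel]) auto
  then show ?thesis
  proof eventually_elim
    fix x assume "ennreal (g x) = ennreal (- g x)"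
    then show "g x = 0"
      by (cases "0 \<le> g x") (auto simp: ennreal_neg ennreal_eq_0_iff dest!: sym[of _ "ennreal _"])
  qed
qed

lemma AE_zero_if_Icc_integrals_zero:
  fixes g :: "real \<Rightarrow> real"
  assumes int: "\<And>K. 0 \<le> K \<Longrightarrow> integrable lborel (\<lambda>t. indicator {0..K} t * g t)"
    and zero: "\<And>K. 0 \<le> K \<Longrightarrow> (LINT t|lborel. indicator {0..K} t * g t) = 0"
  shows "AE t in lborel. 0 \<le> t \<longrightarrow> g t = 0"
proof -
  have "AE t in lborel. indicator {0..real n} t * g t = 0" for n
  proof (rule AE_zero_if_Ioi_integrals_zero[OF int])
    fix a :: real
    consider "a < 0" | "0 \<le> a" "a \<le> n" | "n < a" by linarith
    then show "(LINT x|lborel. indicator {a<..} x * (indicator {0..real n} x * g x)) = 0"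
    proof cases
      case 1
      then have "(LINT x|lborel. indicator {a<..} x * (indicator {0..real n} x * g x))
          = (LINT x|lborel. indicator {0..real n} x * g x)"
        by (intro Bochner_Integration.integral_cong) (auto split: split_indicator)
      then show ?thesis using zero by simp
    next
      case 2
      then have "(LINT x|lborel. indicator {a<..} x * (indicator {0..real n} x * g x))
          = (LINT x|lborel. indicator {0..real n} x * g x - indicator {0..a} x * g x)"
        by (intro Bochner_Integration.integral_cong) (auto split: split_indicator)
      also have "\<dots> = 0" using 2 zero int by simp
      finally show ?thesis .
    next
      case 3
      then have "(\<lambda>x. indicator {a<..} x * (indicator {0..real n} x * g x)) = (\<lambda>x. 0)"
        by (auto split: split_indicator)
      then show ?thesis by simp
    qed
  qed simp
  then have "AE t in lborel. \<forall>n. indicator {0..real n} t * g t = 0"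
    by (subst AE_all_countable) blast
  then show ?thesis
  proof eventually_elim
    fix t :: real assume *: "\<forall>n. indicator {0..real n} t * g t = 0"
    obtain n where "t \<le> real n" using real_arch_simple by blast
    with *[rule_format, of n] show "0 \<le> t \<longrightarrow> g t = 0" by (auto split: split_indicator_asm)
  qed
qed

section \<open>Fubini with only one sign controlled\<close>

text \<open>A control of the negative part by the positive part and the iterated integral. It is of use when the
  integral of the positive part is finite, in which case \<open>g\<close> is integrable.\<close>

lemma nn_integral_negative_part_le:
  fixes g :: "'s \<times> 'w \<Rightarrow> real"
  assumes "sigma_finite_measure L" "sigma_finite_measure M"
    and g [measurable]: "g \<in> borel_measurable (L \<Otimes>\<^sub>M M)"
    and int_L: "AE \<omega> in M. integrable L (\<lambda>s. g (s, \<omega>))"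
    and int_M: "integrable M (\<lambda>\<omega>. LINT s|L. g (s, \<omega>))"
  shows "(\<integral>\<^sup>+z. ennreal (- g z) \<partial>(L \<Otimes>\<^sub>M M))
     \<le> (\<integral>\<^sup>+z. ennreal (g z) \<partial>(L \<Otimes>\<^sub>M M)) + ennreal \<bar>LINT \<omega>|M. LINT s|L. g (s, \<omega>)\<bar>"
proof -
  interpret L: sigma_finite_measure L by fact
  interpret M: sigma_finite_measure M by fact
  interpret pair_sigma_finite L M ..
  define P where "P \<omega> = (\<integral>\<^sup>+s. ennreal (g (s, \<omega>)) \<partial>L)" for \<omega>
  define N where "N \<omega> = (\<integral>\<^sup>+s. ennreal (- g (s, \<omega>)) \<partial>L)" for \<omega>
  define I where "I \<omega> = (LINT s|L. g (s, \<omega>))" for \<omega>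
  have [measurable]: "P \<in> borel_measurable M" "N \<in> borel_measurable M" "I \<in> borel_measurable M"
    unfolding P_def N_def I_def by measurable
  have I: "integrable M I" using int_M unfolding I_def .
  \<comment> \<open>This is \<open>I = P - N\<close>, with both sides split into nonnegative terms to avoid subtraction.\<close>
  have "AE \<omega> in M. N \<omega> + ennreal (I \<omega>) = P \<omega> + ennreal (- I \<omega>)"
    using int_L
  proof eventually_elim
    fix \<omega> assume i: "integrable L (\<lambda>s. g (s, \<omega>))"
    obtain p where p: "P \<omega> = ennreal p" "0 \<le> p"
      using i by (cases "P \<omega>") (auto simp: real_integrable_def P_def)
    obtain n where n: "N \<omega> = ennreal n" "0 \<le> n"
      using i by (cases "N \<omega>") (auto simp: real_integrable_def N_def)
    have I: "I \<omega> = p - n"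
      unfolding I_def using p n by (simp add: real_lebesgue_integral_def[OF i] P_def N_def)
    show "N \<omega> + ennreal (I \<omega>) = P \<omega> + ennreal (- I \<omega>)"
      unfolding p n I using p(2) n(2)
      by (cases "n \<le> p") (simp_all add: ennreal_neg ennreal_plus[symmetric] del: ennreal_plus)
  qed
  then have "(\<integral>\<^sup>+\<omega>. N \<omega> + ennreal (I \<omega>) \<partial>M) = (\<integral>\<^sup>+\<omega>. P \<omega> + ennreal (- I \<omega>) \<partial>M)"
    by (rule nn_integral_cong_AE)
  then have eq: "integral\<^sup>N M N + (\<integral>\<^sup>+\<omega>. ennreal (I \<omega>) \<partial>M) = integral\<^sup>N M P + (\<integral>\<^sup>+\<omega>. ennreal (- I \<omega>) \<partial>M)"
    by (simp add: nn_integral_add)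
  obtain a where a: "(\<integral>\<^sup>+\<omega>. ennreal (I \<omega>) \<partial>M) = ennreal a" "0 \<le> a"
    using I by (cases "\<integral>\<^sup>+\<omega>. ennreal (I \<omega>) \<partial>M") (auto simp: real_integrable_def)
  obtain b where b: "(\<integral>\<^sup>+\<omega>. ennreal (- I \<omega>) \<partial>M) = ennreal b" "0 \<le> b"
    using I by (cases "\<integral>\<^sup>+\<omega>. ennreal (- I \<omega>) \<partial>M") (auto simp: real_integrable_def)
  have EI: "integral\<^sup>L M I = a - b"
    using a b by (simp add: real_lebesgue_integral_def[OF I])
  have "ennreal a + integral\<^sup>N M N = integral\<^sup>N M P + ennreal b"
    using eq unfolding a b by (simp add: ac_simps)
  also have "\<dots> \<le> integral\<^sup>N M P + (ennreal a + ennreal \<bar>a - b\<bar>)"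
    using a(2) b(2) by (intro add_left_mono) (simp add: ennreal_plus[symmetric] del: ennreal_plus)
  also have "\<dots> = ennreal a + (integral\<^sup>N M P + ennreal \<bar>a - b\<bar>)" by (simp add: ac_simps)
  finally have "integral\<^sup>N M N \<le> integral\<^sup>N M P + ennreal \<bar>integral\<^sup>L M I\<bar>"
    unfolding EI by (simp add: ennreal_add_left_cancel_le)
  moreover have "integral\<^sup>N M N = (\<integral>\<^sup>+z. ennreal (- g z) \<partial>(L \<Otimes>\<^sub>M M))"
    unfolding N_def using nn_integral_snd[of "\<lambda>z. ennreal (- g z)"] by simp
  moreover have "integral\<^sup>N M P = (\<integral>\<^sup>+z. ennreal (g z) \<partial>(L \<Otimes>\<^sub>M M))"
    unfolding P_def using nn_integral_snd[of "\<lambda>z. ennreal (g z)"] by simp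
  ultimately show ?thesis by (simp add: I_def[abs_def])
qed

text \<open>The coercion \<open>ennreal\<close> sends negative numbers to zero, so the hypothesis \<open>fin\<close> bounds the integral
  of the positive part of \<open>f\<close>.\<close>

lemma Fubini_positive_part:
  fixes f :: "('s \<times> 'w) \<times> 'q \<Rightarrow> real"
  assumes L: "sigma_finite_measure L" and M: "sigma_finite_measure M" and Q: "sigma_finite_measure Q"
    and f [measurable]: "f \<in> borel_measurable ((L \<Otimes>\<^sub>M M) \<Otimes>\<^sub>M Q)"
    and fin: "(\<integral>\<^sup>+z. ennreal (f z) \<partial>((L \<Otimes>\<^sub>M M) \<Otimes>\<^sub>M Q)) < \<infinity>"
    and int_L: "\<And>q. q \<in> space Q \<Longrightarrow> AE \<omega> in M. integrable L (\<lambda>s. f ((s, \<omega>), q))"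
    and int_M: "\<And>q. q \<in> space Q \<Longrightarrow> integrable M (\<lambda>\<omega>. LINT s|L. f ((s, \<omega>), q))"
    and int_Q: "integrable Q (\<lambda>q. LINT \<omega>|M. LINT s|L. f ((s, \<omega>), q))"
  shows "integral\<^sup>L ((L \<Otimes>\<^sub>M M) \<Otimes>\<^sub>M Q) f = (LINT q|Q. LINT \<omega>|M. LINT s|L. f ((s, \<omega>), q))"
proof -
  interpret L: sigma_finite_measure L by fact
  interpret M: sigma_finite_measure M by fact
  interpret Q: sigma_finite_measure Q by fact
  interpret LM: pair_sigma_finite L M ..
  interpret pair_sigma_finite "L \<Otimes>\<^sub>M M" Q ..
  have "(\<integral>\<^sup>+z. ennreal (- f z) \<partial>((L \<Otimes>\<^sub>M M) \<Otimes>\<^sub>M Q))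
      = (\<integral>\<^sup>+q. \<integral>\<^sup>+p. ennreal (- f (p, q)) \<partial>(L \<Otimes>\<^sub>M M) \<partial>Q)"
    by (subst nn_integral_snd[symmetric]) auto
  also have "\<dots> \<le> (\<integral>\<^sup>+q. (\<integral>\<^sup>+p. ennreal (f (p, q)) \<partial>(L \<Otimes>\<^sub>M M))
        + ennreal \<bar>LINT \<omega>|M. LINT s|L. f ((s, \<omega>), q)\<bar> \<partial>Q)"
    by (intro nn_integral_mono nn_integral_negative_part_le L M int_L int_M) auto
  also have "\<dots> = (\<integral>\<^sup>+q. \<integral>\<^sup>+p. ennreal (f (p, q)) \<partial>(L \<Otimes>\<^sub>M M) \<partial>Q)
        + (\<integral>\<^sup>+q. ennreal \<bar>LINT \<omega>|M. LINT s|L. f ((s, \<omega>), q)\<bar> \<partial>Q)"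
    by (intro nn_integral_add) auto
  also have "\<dots> = (\<integral>\<^sup>+z. ennreal (f z) \<partial>((L \<Otimes>\<^sub>M M) \<Otimes>\<^sub>M Q))
        + (\<integral>\<^sup>+q. ennreal \<bar>LINT \<omega>|M. LINT s|L. f ((s, \<omega>), q)\<bar> \<partial>Q)"
    by (subst nn_integral_snd[symmetric]) auto
  also have "\<dots> < \<infinity>"
    using fin int_Q by (auto simp: integrable_iff_bounded less_top)
  finally have f_int: "integrable ((L \<Otimes>\<^sub>M M) \<Otimes>\<^sub>M Q) f"
    using fin by (auto simp: real_integrable_def less_top)
  have f': "integrable ((L \<Otimes>\<^sub>M M) \<Otimes>\<^sub>M Q) (case_prod (\<lambda>p q. f (p, q)))"
    using f_int by simp
  have "integral\<^sup>L ((L \<Otimes>\<^sub>M M) \<Otimes>\<^sub>M Q) f = (LINT q|Q. LINT p|(L \<Otimes>\<^sub>M M). f (p, q))"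
    using integral_snd[OF f'] by simp
  also have "\<dots> = (LINT q|Q. LINT \<omega>|M. LINT s|L. f ((s, \<omega>), q))"
  proof (rule integral_cong_AE)
    show "AE q in Q. (LINT p|(L \<Otimes>\<^sub>M M). f (p, q)) = (LINT \<omega>|M. LINT s|L. f ((s, \<omega>), q))"
      using AE_integrable_snd[OF f']
    proof eventually_elim
      fix q assume "integrable (L \<Otimes>\<^sub>M M) (\<lambda>p. f (p, q))"
      then have "integrable (L \<Otimes>\<^sub>M M) (case_prod (\<lambda>s \<omega>. f ((s, \<omega>), q)))"
        by (simp add: case_prod_beta')
      from LM.integral_snd[OF this] show "(LINT p|(L \<Otimes>\<^sub>M M). f (p, q)) = (LINT \<omega>|M. LINT s|L. f ((s, \<omega>), q))"
        by (simp add: case_prod_beta')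
    qed
  qed auto
  finally show ?thesis .
qed

text \<open>Fubini's theorem when only one of the two parts of \<open>f\<close> is known to be integrable: since the iterated
  integral exists in one order and is integrable over the last variable, the other part must be
  integrable as well.\<close>

lemma Fubini_one_sided:
  fixes f :: "('s \<times> 'w) \<times> 'q \<Rightarrow> real"
  assumes L: "sigma_finite_measure L" and M: "sigma_finite_measure M" and Q: "sigma_finite_measure Q"
    and f [measurable]: "f \<in> borel_measurable ((L \<Otimes>\<^sub>M M) \<Otimes>\<^sub>M Q)"
    and fin: "(\<integral>\<^sup>+z. ennreal (f z) \<partial>((L \<Otimes>\<^sub>M M) \<Otimes>\<^sub>M Q)) < \<infinity> \<or>
      (\<integral>\<^sup>+z. ennreal (- f z) \<partial>((L \<Otimes>\<^sub>M M) \<Otimes>\<^sub>M Q)) < \<infinity>"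
    and int_L: "\<And>q. q \<in> space Q \<Longrightarrow> AE \<omega> in M. integrable L (\<lambda>s. f ((s, \<omega>), q))"
    and int_M: "\<And>q. q \<in> space Q \<Longrightarrow> integrable M (\<lambda>\<omega>. LINT s|L. f ((s, \<omega>), q))"
    and int_Q: "integrable Q (\<lambda>q. LINT \<omega>|M. LINT s|L. f ((s, \<omega>), q))"
  shows "integral\<^sup>L ((L \<Otimes>\<^sub>M M) \<Otimes>\<^sub>M Q) f = (LINT q|Q. LINT \<omega>|M. LINT s|L. f ((s, \<omega>), q))"
  using fin
proof
  assume "(\<integral>\<^sup>+z. ennreal (f z) \<partial>((L \<Otimes>\<^sub>M M) \<Otimes>\<^sub>M Q)) < \<infinity>"
  from Fubini_positive_part[OF L M Q f this int_L int_M int_Q] show ?thesis .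
next
  assume *: "(\<integral>\<^sup>+z. ennreal (- f z) \<partial>((L \<Otimes>\<^sub>M M) \<Otimes>\<^sub>M Q)) < \<infinity>"
  have "integral\<^sup>L ((L \<Otimes>\<^sub>M M) \<Otimes>\<^sub>M Q) (\<lambda>z. - f z) = (LINT q|Q. LINT \<omega>|M. LINT s|L. - f ((s, \<omega>), q))"
    using * int_L int_M int_Q by (intro Fubini_positive_part L M Q) auto
  then show ?thesis by simp
qed

section \<open>Stopped processes, independence and martingale means\<close>

text \<open>The stopped process \<open>X\<^bsub>t \<and> \<sigma>\<^esub>\<close>. It is defined for every real \<open>t\<close> and equals \<open>X\<^sub>0\<close> for \<open>t < 0\<close>,
  because \<open>ennreal t = 0\<close> there; this allows measurability on the whole line.\<close>

definition stopped :: "(real \<Rightarrow> 'w \<Rightarrow> 'e) \<Rightarrow> ('w \<Rightarrow> ennreal) \<Rightarrow> real \<Rightarrow> 'w \<Rightarrow> 'e" where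
  "stopped X \<sigma> t \<omega> = X (tmin (ennreal t) (\<sigma> \<omega>)) \<omega>"

lemma tmin_nonneg [simp]: "0 \<le> tmin a b"
  by (simp add: tmin_def)

lemma tmin_0 [simp]: "tmin 0 a = 0"
  by (simp add: tmin_def)

lemma tmin_eq_left: "0 \<le> t \<Longrightarrow> ennreal t \<le> a \<Longrightarrow> tmin (ennreal t) a = t"
  by (simp add: tmin_def min_def)

lemma tmin_eq_right: "a \<le> ennreal t \<Longrightarrow> tmin (ennreal t) a = enn2real a"
  by (simp add: tmin_def min_def)

lemma le_tmin_iff: "0 \<le> s \<Longrightarrow> 0 \<le> t \<Longrightarrow> s \<le> tmin (ennreal t) a \<longleftrightarrow> s \<le> t \<and> ennreal s \<le> a"
  by (cases a) (auto simp: tmin_def min_def)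

lemma measurable_process_comp:
  assumes X: "measurable_process M E X"
    and T: "T \<in> borel_measurable N" and W: "W \<in> N \<rightarrow>\<^sub>M M" and pos: "\<And>z. z \<in> space N \<Longrightarrow> 0 \<le> T z"
  shows "(\<lambda>z. X (T z) (W z)) \<in> N \<rightarrow>\<^sub>M E"
proof -
  have "(\<lambda>z. (T z, W z)) \<in> N \<rightarrow>\<^sub>M restrict_space borel {0..} \<Otimes>\<^sub>M M"
    using T W pos by (intro measurable_Pair measurable_restrict_space2) auto
  from measurable_compose[OF this X[unfolded measurable_process_def]] show ?thesis by simp
qed

lemma measurable_stopped:
  assumes X: "measurable_process M E X" and [measurable]: "\<sigma> \<in> borel_measurable M"
    and [measurable]: "T \<in> borel_measurable N" "W \<in> N \<rightarrow>\<^sub>M M"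
  shows "(\<lambda>z. stopped X \<sigma> (T z) (W z)) \<in> N \<rightarrow>\<^sub>M E"
  unfolding stopped_def by (intro measurable_process_comp[OF X]) (simp_all add: tmin_def)

lemma indep_elements_iff:
  assumes "prob_space M"
  shows "indep_elements M S A T B \<longleftrightarrow> A \<in> M \<rightarrow>\<^sub>M S \<and> B \<in> M \<rightarrow>\<^sub>M T \<and>
    (\<forall>C\<in>sets S. \<forall>D\<in>sets T. measure M ((A -` C \<inter> space M) \<inter> (B -` D \<inter> space M))
       = measure M (A -` C \<inter> space M) * measure M (B -` D \<inter> space M))"
  unfolding indep_elements_def prob_space.indep_sets2_eq[OF assms]
  by (auto simp: setcompr_eq_image image_subset_iff measurable_sets simp del: vimage_Int)

lemma indep_elements_sym:
  assumes M: "prob_space M" and indep: "indep_elements M S A T B"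
  shows "indep_elements M T B S A"
proof -
  have "(B -` C \<inter> space M) \<inter> (A -` D \<inter> space M) = (A -` D \<inter> space M) \<inter> (B -` C \<inter> space M)" for C D
    by (rule Int_commute)
  then show ?thesis
    using indep unfolding indep_elements_iff[OF M] by (simp add: mult.commute)
qed

text \<open>Independence says that the two elements, evaluated at the same sample point, have the same joint law
  as when they are evaluated at two independent sample points.\<close>

lemma indep_elements_distr:
  assumes M: "prob_space M" and indep: "indep_elements M S A T B"
  shows "distr M (S \<Otimes>\<^sub>M T) (\<lambda>\<omega>. (A \<omega>, B \<omega>)) = distr (M \<Otimes>\<^sub>M M) (S \<Otimes>\<^sub>M T) (\<lambda>(\<omega>, \<omega>'). (A \<omega>, B \<omega>'))"
proof -
  interpret prob_space M by fact
  have [measurable]: "A \<in> M \<rightarrow>\<^sub>M S" "B \<in> M \<rightarrow>\<^sub>M T"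
    using indep by (auto simp: indep_elements_def)
  interpret A: prob_space "distr M S A" by (rule prob_space_distr) simp
  interpret B: prob_space "distr M T B" by (rule prob_space_distr) simp
  have "distr M S A \<Otimes>\<^sub>M distr M T B = distr M (S \<Otimes>\<^sub>M T) (\<lambda>\<omega>. (A \<omega>, B \<omega>))"
  proof (rule pair_measure_eqI)
    fix C D assume "C \<in> sets (distr M S A)" "D \<in> sets (distr M T B)"
    then have [measurable]: "C \<in> sets S" "D \<in> sets T" by auto
    have "prob ((A -` C \<inter> space M) \<inter> (B -` D \<inter> space M)) = prob (A -` C \<inter> space M) * prob (B -` D \<inter> space M)"
      using indep \<open>C \<in> sets S\<close> \<open>D \<in> sets T\<close> unfolding indep_elements_iff[OF M] by blast
    moreover have "(\<lambda>\<omega>. (A \<omega>, B \<omega>)) -` (C \<times> D) \<inter> space M = (A -` C \<inter> space M) \<inter> (B -` D \<inter> space M)"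
      by auto
    ultimately show "emeasure (distr M S A) C * emeasure (distr M T B) D
        = emeasure (distr M (S \<Otimes>\<^sub>M T) (\<lambda>\<omega>. (A \<omega>, B \<omega>))) (C \<times> D)"
      by (simp add: emeasure_distr emeasure_eq_measure ennreal_mult'')
  qed (auto intro: A.sigma_finite_measure_axioms B.sigma_finite_measure_axioms)
  moreover have "distr M S A \<Otimes>\<^sub>M distr M T B = distr (M \<Otimes>\<^sub>M M) (S \<Otimes>\<^sub>M T) (\<lambda>(\<omega>, \<omega>'). (A \<omega>, B \<omega>'))"
    by (intro pair_measure_distr B.sigma_finite_measure_axioms) auto
  ultimately show ?thesis by simp
qed

lemma martingale_mean:
  assumes M: "prob_space M" and Z: "martingale M Z" and t: "0 \<le> t"
  shows "integrable M (Z t)" "integral\<^sup>L M (Z t) = integral\<^sup>L M (Z 0)"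
proof -
  interpret prob_space M by fact
  obtain \<F> where \<F>: "martingale_wrt M \<F> Z" using Z by (auto simp: martingale_def)
  then have sub: "subalgebra M (\<F> 0)" and i: "\<And>t. 0 \<le> t \<Longrightarrow> integrable M (Z t)"
    and c: "AE \<omega> in M. real_cond_exp M (\<F> 0) (Z t) \<omega> = Z 0 \<omega>"
    using t by (auto simp: martingale_wrt_def)
  show "integrable M (Z t)" using i t .
  interpret finite_measure_subalgebra M "\<F> 0" by standard (rule sub)
  have "integral\<^sup>L M (Z t) = (LINT \<omega>|M. real_cond_exp M (\<F> 0) (Z t) \<omega>)"
    using real_cond_exp_int(2)[OF i[OF t]] by simp
  also have "\<dots> = integral\<^sup>L M (Z 0)"
    using c i by (intro integral_cong_AE) auto
  finally show "integral\<^sup>L M (Z t) = integral\<^sup>L M (Z 0)" .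
qed

section \<open>Decoupling two independent stopped processes\<close>

text \<open>The function \<open>f\<close> of the introductory remarks. Its arguments are two pairs of a time and a sample point.\<close>

definition duality_integrand ::
  "(real \<Rightarrow> 'w \<Rightarrow> 'e) \<Rightarrow> ('w \<Rightarrow> ennreal) \<Rightarrow> (real \<Rightarrow> 'w \<Rightarrow> 'f) \<Rightarrow> ('w \<Rightarrow> ennreal) \<Rightarrow> ('e \<Rightarrow> 'f \<Rightarrow> real) \<Rightarrow>
    real \<Rightarrow> (real \<times> 'w) \<times> (real \<times> 'w) \<Rightarrow> real" where
  "duality_integrand X \<sigma> Y \<tau> \<phi> K = (\<lambda>((s, \<omega>), (t, \<omega>')).
     if 0 \<le> s \<and> ennreal s \<le> \<sigma> \<omega> \<and> 0 \<le> t \<and> ennreal t \<le> \<tau> \<omega>' \<and> s + t \<le> K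
     then \<phi> (stopped X \<sigma> s \<omega>) (stopped Y \<tau> t \<omega>') else 0)"

lemma duality_integrand_swap:
  "duality_integrand Y \<tau> X \<sigma> (\<lambda>y x. \<phi> x y) K = (\<lambda>(q, p). duality_integrand X \<sigma> Y \<tau> \<phi> K (p, q))"
  by (auto simp: duality_integrand_def fun_eq_iff add.commute)

text \<open>Two processes with random times that are independent of each other. The setting is symmetric in the
  two, so it can be used with \<open>(X, \<sigma>)\<close> and \<open>(Y, \<tau>)\<close> exchanged.\<close>

locale independent_stopped_processes = prob_space M for M :: "'w measure" +
  fixes E :: "'e measure" and F :: "'f measure"
    and X :: "real \<Rightarrow> 'w \<Rightarrow> 'e" and \<sigma> :: "'w \<Rightarrow> ennreal"
    and Y :: "real \<Rightarrow> 'w \<Rightarrow> 'f" and \<tau> :: "'w \<Rightarrow> ennreal"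
  assumes X: "measurable_process M E X" and \<sigma> [measurable]: "\<sigma> \<in> borel_measurable M"
    and Y: "measurable_process M F Y" and \<tau> [measurable]: "\<tau> \<in> borel_measurable M"
    and indep: "indep_elements M (path_space E) (path_with_time X \<sigma>)
                  (path_space F) (path_with_time Y \<tau>)"
begin

abbreviation "x \<equiv> stopped X \<sigma>"
abbreviation "y \<equiv> stopped Y \<tau>"

sublocale MM: pair_prob_space M M ..
sublocale LM: pair_sigma_finite lborel M ..
sublocale LMLM: pair_sigma_finite "lborel \<Otimes>\<^sub>M M" "lborel \<Otimes>\<^sub>M M" ..

lemmas measurable_x [measurable (raw)] = measurable_stopped[OF X \<sigma>]
lemmas measurable_y [measurable (raw)] = measurable_stopped[OF Y \<tau>]

lemma x_space: "\<omega> \<in> space M \<Longrightarrow> x s \<omega> \<in> space E"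
  by (rule measurable_space[of _ M]) measurable

lemma y_space: "\<omega> \<in> space M \<Longrightarrow> y s \<omega> \<in> space F"
  by (rule measurable_space[of _ M]) measurable

text \<open>Only fixed times \<open>s\<close> and \<open>t\<close> are considered: the coordinates of the path at fixed times are measurable
  on path space, whereas evaluation at a random time is not.\<close>

lemma decoupled_distr:
  assumes "0 \<le> s" "0 \<le> t"
  shows "distr M (E \<Otimes>\<^sub>M (F \<Otimes>\<^sub>M borel)) (\<lambda>\<omega>. (x s \<omega>, y t \<omega>, \<tau> \<omega>))
    = distr (M \<Otimes>\<^sub>M M) (E \<Otimes>\<^sub>M (F \<Otimes>\<^sub>M borel)) (\<lambda>(\<omega>, \<omega>'). (x s \<omega>, y t \<omega>', \<tau> \<omega>'))"
proof -
  define r :: "((real \<Rightarrow> 'e) \<times> (real \<Rightarrow> 'e) \<times> ennreal) \<times> ((real \<Rightarrow> 'f) \<times> (real \<Rightarrow> 'f) \<times> ennreal) \<Rightarrow> 'e \<times> 'f \<times> ennreal"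
    where "r = (\<lambda>(a, b). (fst (snd a) s, fst (snd b) t, snd (snd b)))"
  have [measurable]: "r \<in> path_space E \<Otimes>\<^sub>M path_space F \<rightarrow>\<^sub>M E \<Otimes>\<^sub>M (F \<Otimes>\<^sub>M borel)"
    using assms unfolding r_def path_space_def
    by (auto simp: case_prod_beta' intro!: measurable_Pair measurable_compose[OF _ measurable_component_singleton])
  have [measurable]: "path_with_time X \<sigma> \<in> M \<rightarrow>\<^sub>M path_space E" "path_with_time Y \<tau> \<in> M \<rightarrow>\<^sub>M path_space F"
    using indep by (auto simp: indep_elements_def)
  have "distr (distr M (path_space E \<Otimes>\<^sub>M path_space F) (\<lambda>\<omega>. (path_with_time X \<sigma> \<omega>, path_with_time Y \<tau> \<omega>)))
      (E \<Otimes>\<^sub>M (F \<Otimes>\<^sub>M borel)) r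
    = distr (distr (M \<Otimes>\<^sub>M M) (path_space E \<Otimes>\<^sub>M path_space F)
       (\<lambda>(\<omega>, \<omega>'). (path_with_time X \<sigma> \<omega>, path_with_time Y \<tau> \<omega>'))) (E \<Otimes>\<^sub>M (F \<Otimes>\<^sub>M borel)) r"
    by (simp add: indep_elements_distr[OF prob_space_axioms indep])
  moreover have "r (path_with_time X \<sigma> \<omega>, path_with_time Y \<tau> \<omega>') = (x s \<omega>, y t \<omega>', \<tau> \<omega>')" for \<omega> \<omega>'
    using assms by (simp add: r_def path_with_time_def stopped_def)
  ultimately show ?thesis
    by (simp add: distr_distr comp_def case_prod_beta')
qed

lemma decoupled_nn_integral:
  assumes st: "0 \<le> s" "0 \<le> t" and g [measurable]: "case_prod g \<in> borel_measurable (E \<Otimes>\<^sub>M F)"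
  shows "(\<integral>\<^sup>+\<omega>. g (x s \<omega>) (y t \<omega>) \<partial>M) = (\<integral>\<^sup>+\<omega>'. \<integral>\<^sup>+\<omega>. g (x s \<omega>) (y t \<omega>') \<partial>M \<partial>M)"
proof -
  have "(\<integral>\<^sup>+\<omega>. g (x s \<omega>) (y t \<omega>) \<partial>M) =
      (\<integral>\<^sup>+z. g (fst z) (fst (snd z)) \<partial>distr M (E \<Otimes>\<^sub>M (F \<Otimes>\<^sub>M borel)) (\<lambda>\<omega>. (x s \<omega>, y t \<omega>, \<tau> \<omega>)))"
    by (subst nn_integral_distr) auto
  also have "\<dots> = (\<integral>\<^sup>+z. g (x s (fst z)) (y t (snd z)) \<partial>(M \<Otimes>\<^sub>M M))"
    unfolding decoupled_distr[OF st] by (subst nn_integral_distr) (auto simp: case_prod_beta')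
  also have "\<dots> = (\<integral>\<^sup>+\<omega>'. \<integral>\<^sup>+\<omega>. g (x s \<omega>) (y t \<omega>') \<partial>M \<partial>M)"
    by (subst MM.nn_integral_snd[symmetric]) auto
  finally show ?thesis .
qed

lemma decoupled_integral:
  fixes g :: "'e \<Rightarrow> 'f \<Rightarrow> real"
  assumes st: "0 \<le> s" "0 \<le> t" and g [measurable]: "case_prod g \<in> borel_measurable (E \<Otimes>\<^sub>M F)"
    and bdd: "\<And>a b. a \<in> space E \<Longrightarrow> b \<in> space F \<Longrightarrow> \<bar>g a b\<bar> \<le> C"
    and j [measurable]: "Measurable.pred borel j"
  shows "(LINT \<omega>|M. (if j (\<tau> \<omega>) then g (x s \<omega>) (y t \<omega>) else 0))
     = (LINT \<omega>'|M. (if j (\<tau> \<omega>') then (LINT \<omega>|M. g (x s \<omega>) (y t \<omega>')) else 0))"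
proof -
  have "(LINT \<omega>|M. (if j (\<tau> \<omega>) then g (x s \<omega>) (y t \<omega>) else 0)) =
      (LINT z|distr M (E \<Otimes>\<^sub>M (F \<Otimes>\<^sub>M borel)) (\<lambda>\<omega>. (x s \<omega>, y t \<omega>, \<tau> \<omega>)).
         (if j (snd (snd z)) then g (fst z) (fst (snd z)) else 0))"
    by (subst integral_distr) (auto cong: if_cong)
  also have "\<dots> = (LINT z|(M \<Otimes>\<^sub>M M). (if j (\<tau> (snd z)) then g (x s (fst z)) (y t (snd z)) else 0))"
    unfolding decoupled_distr[OF st] by (subst integral_distr) (auto simp: case_prod_beta' cong: if_cong)
  also have "\<dots> = (LINT \<omega>'|M. LINT \<omega>|M. (if j (\<tau> \<omega>') then g (x s \<omega>) (y t \<omega>') else 0))"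
  proof (subst MM.integral_snd)
    show "integrable (M \<Otimes>\<^sub>M M) (\<lambda>(\<omega>, \<omega>'). if j (\<tau> \<omega>') then g (x s \<omega>) (y t \<omega>') else 0)"
    proof (rule MM.P.integrable_const_bound[of _ "\<bar>C\<bar>"])
      show "AE z in M \<Otimes>\<^sub>M M. norm (case z of (\<omega>, \<omega>') \<Rightarrow> if j (\<tau> \<omega>') then g (x s \<omega>) (y t \<omega>') else 0) \<le> \<bar>C\<bar>"
      proof (rule AE_I2)
        fix z assume "z \<in> space (M \<Otimes>\<^sub>M M)"
        then have "\<bar>g (x s (fst z)) (y t (snd z))\<bar> \<le> C"
          by (intro bdd x_space y_space) (auto simp: space_pair_measure)
        then show "norm (case z of (\<omega>, \<omega>') \<Rightarrow> if j (\<tau> \<omega>') then g (x s \<omega>) (y t \<omega>') else 0) \<le> \<bar>C\<bar>"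
          by (auto simp: case_prod_beta')
      qed
    qed measurable
  qed (simp add: case_prod_beta')
  also have "\<dots> = (LINT \<omega>'|M. (if j (\<tau> \<omega>') then (LINT \<omega>|M. g (x s \<omega>) (y t \<omega>')) else 0))"
    by (intro Bochner_Integration.integral_cong) auto
  finally show ?thesis .
qed

lemma measurable_duality_integrand:
  assumes [measurable]: "case_prod \<phi> \<in> borel_measurable (E \<Otimes>\<^sub>M F)"
  shows "duality_integrand X \<sigma> Y \<tau> \<phi> K \<in> borel_measurable ((lborel \<Otimes>\<^sub>M M) \<Otimes>\<^sub>M (lborel \<Otimes>\<^sub>M M))"
  unfolding duality_integrand_def case_prod_beta' case_prod_beta by measurable

text \<open>The conclusion involves two independent sample points, the hypothesis only one; the two agree by
  independence at each pair of fixed times. The integrand is supported on times up to \<open>\<sigma>\<close> and \<open>\<tau>\<close>, so the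
  bound on the whole triangle \<open>s + t \<le> K\<close> is more than enough.\<close>

lemma duality_integrand_one_sided_integrable:
  fixes \<psi> :: "'e \<Rightarrow> 'f \<Rightarrow> real"
  assumes \<psi> [measurable]: "case_prod \<psi> \<in> borel_measurable (E \<Otimes>\<^sub>M F)"
    and fin: "(\<integral>\<^sup>+t\<in>{0..K}. (\<integral>\<^sup>+s\<in>{0..K}. (\<integral>\<^sup>+\<omega>. ennreal (\<psi> (x s \<omega>) (y t \<omega>)) \<partial>M)
             * indicator {0..K} (s + t) \<partial>lborel) \<partial>lborel) < \<infinity>"
  shows "(\<integral>\<^sup>+z. ennreal (duality_integrand X \<sigma> Y \<tau> \<psi> K z) \<partial>((lborel \<Otimes>\<^sub>M M) \<Otimes>\<^sub>M (lborel \<Otimes>\<^sub>M M))) < \<infinity>"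
proof -
  let ?f = "\<lambda>s \<omega> t \<omega>'. ennreal (duality_integrand X \<sigma> Y \<tau> \<psi> K ((s, \<omega>), (t, \<omega>')))"
  note [measurable] = measurable_duality_integrand[OF \<psi>, of K]
  have "(\<integral>\<^sup>+z. ennreal (duality_integrand X \<sigma> Y \<tau> \<psi> K z) \<partial>((lborel \<Otimes>\<^sub>M M) \<Otimes>\<^sub>M (lborel \<Otimes>\<^sub>M M)))
      = (\<integral>\<^sup>+q. \<integral>\<^sup>+p. ennreal (duality_integrand X \<sigma> Y \<tau> \<psi> K (p, q)) \<partial>(lborel \<Otimes>\<^sub>M M) \<partial>(lborel \<Otimes>\<^sub>M M))"
    by (subst LMLM.nn_integral_snd) auto
  also have "\<dots> = (\<integral>\<^sup>+t. \<integral>\<^sup>+\<omega>'. \<integral>\<^sup>+s. \<integral>\<^sup>+\<omega>. ?f s \<omega> t \<omega>' \<partial>M \<partial>lborel \<partial>M \<partial>lborel)"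
  proof (subst nn_integral_fst[symmetric])
    show "(\<integral>\<^sup>+t. \<integral>\<^sup>+\<omega>'. \<integral>\<^sup>+p. ennreal (duality_integrand X \<sigma> Y \<tau> \<psi> K (p, (t, \<omega>'))) \<partial>(lborel \<Otimes>\<^sub>M M) \<partial>M \<partial>lborel)
        = (\<integral>\<^sup>+t. \<integral>\<^sup>+\<omega>'. \<integral>\<^sup>+s. \<integral>\<^sup>+\<omega>. ?f s \<omega> t \<omega>' \<partial>M \<partial>lborel \<partial>M \<partial>lborel)"
      by (intro nn_integral_cong nn_integral_fst[symmetric]) measurable
  qed measurable
  also have "\<dots> = (\<integral>\<^sup>+t. \<integral>\<^sup>+s. \<integral>\<^sup>+\<omega>'. \<integral>\<^sup>+\<omega>. ?f s \<omega> t \<omega>' \<partial>M \<partial>M \<partial>lborel \<partial>lborel)"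
    by (intro nn_integral_cong LM.Fubini') measurable
  also have "\<dots> \<le> (\<integral>\<^sup>+t. \<integral>\<^sup>+s. \<integral>\<^sup>+\<omega>'. \<integral>\<^sup>+\<omega>. (indicator {0..K} t * (indicator {0..K} s * indicator {0..K} (s + t)))
       * ennreal (\<psi> (x s \<omega>) (y t \<omega>')) \<partial>M \<partial>M \<partial>lborel \<partial>lborel)"
    by (intro nn_integral_mono) (auto simp: duality_integrand_def split: split_indicator)
  also have "\<dots> = (\<integral>\<^sup>+t. \<integral>\<^sup>+s. (indicator {0..K} t * (indicator {0..K} s * indicator {0..K} (s + t)))
       * (\<integral>\<^sup>+\<omega>. ennreal (\<psi> (x s \<omega>) (y t \<omega>)) \<partial>M) \<partial>lborel \<partial>lborel)"
  proof (intro nn_integral_cong)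
    fix t s :: real
    let ?c = "indicator {0..K} t * (indicator {0..K} s * indicator {0..K} (s + t)) :: ennreal"
    show "(\<integral>\<^sup>+\<omega>'. \<integral>\<^sup>+\<omega>. ?c * ennreal (\<psi> (x s \<omega>) (y t \<omega>')) \<partial>M \<partial>M) = ?c * (\<integral>\<^sup>+\<omega>. ennreal (\<psi> (x s \<omega>) (y t \<omega>)) \<partial>M)"
    proof (cases "0 \<le> s \<and> 0 \<le> t")
      case True
      then have "(\<integral>\<^sup>+\<omega>'. \<integral>\<^sup>+\<omega>. ?c * ennreal (\<psi> (x s \<omega>) (y t \<omega>')) \<partial>M \<partial>M) = (\<integral>\<^sup>+\<omega>. ?c * ennreal (\<psi> (x s \<omega>) (y t \<omega>)) \<partial>M)"
        by (intro decoupled_nn_integral[symmetric]) auto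
      also have "\<dots> = ?c * (\<integral>\<^sup>+\<omega>. ennreal (\<psi> (x s \<omega>) (y t \<omega>)) \<partial>M)"
        by (intro nn_integral_cmult) measurable
      finally show ?thesis .
    qed auto
  qed
  also have "\<dots> = (\<integral>\<^sup>+t\<in>{0..K}. (\<integral>\<^sup>+s\<in>{0..K}. (\<integral>\<^sup>+\<omega>. ennreal (\<psi> (x s \<omega>) (y t \<omega>)) \<partial>M)
             * indicator {0..K} (s + t) \<partial>lborel) \<partial>lborel)"
    by (intro nn_integral_cong) (auto simp: ac_simps split: split_indicator)
  finally show ?thesis using fin by (rule order.strict_trans1)
qed

end

section \<open>Integrating the first process out\<close>

text \<open>The variable \<open>(H(X\<^bsub>(t-\<tau>) \<and> \<sigma>\<^esub>, Y\<^sub>\<tau>) - H(X\<^sub>0, Y\<^sub>\<tau>)) 1\<^bsub>\<tau> \<le> t\<^esub>\<close>, whose mean is \<open>c\<^sub>X(t)\<close>.\<close>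

definition shifted_increment ::
  "(real \<Rightarrow> 'w \<Rightarrow> 'e) \<Rightarrow> ('w \<Rightarrow> ennreal) \<Rightarrow> (real \<Rightarrow> 'w \<Rightarrow> 'f) \<Rightarrow> ('w \<Rightarrow> ennreal) \<Rightarrow> ('e \<Rightarrow> 'f \<Rightarrow> real) \<Rightarrow>
    real \<Rightarrow> 'w \<Rightarrow> real" where
  "shifted_increment X \<sigma> Y \<tau> H t \<omega> =
     (if \<tau> \<omega> \<le> ennreal t
      then H (stopped X \<sigma> (t - enn2real (\<tau> \<omega>)) \<omega>) (Y (enn2real (\<tau> \<omega>)) \<omega>)
         - H (stopped X \<sigma> 0 \<omega>) (Y (enn2real (\<tau> \<omega>)) \<omega>)
      else 0)"

text \<open>One half of the duality hypotheses: only the compensated process built from \<open>X\<close> is assumed to be a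
  martingale. The other half is the same locale with \<open>X\<close> and \<open>Y\<close> exchanged and the arguments of \<open>H\<close> and
  \<open>\<phi>\<close> swapped.\<close>

locale independent_with_martingale = independent_stopped_processes M E F X \<sigma> Y \<tau>
  for M :: "'w measure" and E :: "'e measure" and F :: "'f measure"
    and X :: "real \<Rightarrow> 'w \<Rightarrow> 'e" and \<sigma> :: "'w \<Rightarrow> ennreal"
    and Y :: "real \<Rightarrow> 'w \<Rightarrow> 'f" and \<tau> :: "'w \<Rightarrow> ennreal" +
  fixes H \<phi> :: "'e \<Rightarrow> 'f \<Rightarrow> real" and C :: real
  assumes H_meas: "case_prod H \<in> borel_measurable (E \<Otimes>\<^sub>M F)"
    and H_bdd: "\<And>a b. a \<in> space E \<Longrightarrow> b \<in> space F \<Longrightarrow> \<bar>H a b\<bar> \<le> C"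
    and \<phi>_meas: "case_prod \<phi> \<in> borel_measurable (E \<Otimes>\<^sub>M F)"
    and X_int: "\<And>b t. b \<in> space F \<Longrightarrow> 0 \<le> t \<Longrightarrow>
         AE \<omega> in M. set_integrable lborel {0..tmin (ennreal t) (\<sigma> \<omega>)} (\<lambda>s. \<phi> (X s \<omega>) b)"
    and X_mart: "\<And>b. b \<in> space F \<Longrightarrow>
         martingale M (\<lambda>t \<omega>. H (X (tmin (ennreal t) (\<sigma> \<omega>)) \<omega>) b
           - (LINT s:{0..tmin (ennreal t) (\<sigma> \<omega>)}|lborel. \<phi> (X s \<omega>) b))"
begin

lemma measurable_H [measurable (raw)]:
  assumes [measurable]: "u \<in> N \<rightarrow>\<^sub>M E" "v \<in> N \<rightarrow>\<^sub>M F"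
  shows "(\<lambda>z. H (u z) (v z)) \<in> borel_measurable N"
  using measurable_compose[OF measurable_Pair[OF assms] H_meas] by simp

lemma measurable_\<phi> [measurable (raw)]:
  assumes [measurable]: "u \<in> N \<rightarrow>\<^sub>M E" "v \<in> N \<rightarrow>\<^sub>M F"
  shows "(\<lambda>z. \<phi> (u z) (v z)) \<in> borel_measurable N"
  using measurable_compose[OF measurable_Pair[OF assms] \<phi>_meas] by simp

lemma measurable_Y_\<tau> [measurable (raw)]:
  assumes [measurable]: "W \<in> N \<rightarrow>\<^sub>M M"
  shows "(\<lambda>z. Y (enn2real (\<tau> (W z))) (W z)) \<in> N \<rightarrow>\<^sub>M F"
  by (intro measurable_process_comp[OF Y]) auto

lemma Y_\<tau>_space: "\<omega> \<in> space M \<Longrightarrow> Y (enn2real (\<tau> \<omega>)) \<omega> \<in> space F"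
  by (rule measurable_space[of "\<lambda>\<omega>. Y (enn2real (\<tau> \<omega>)) \<omega>" M]) measurable

lemma integrable_bounded:
  fixes g :: "'w \<Rightarrow> real"
  assumes "g \<in> borel_measurable M" "\<And>\<omega>. \<omega> \<in> space M \<Longrightarrow> \<bar>g \<omega>\<bar> \<le> B"
  shows "integrable M g"
  using assms by (intro integrable_const_bound[of _ B]) auto

lemma abs_integral_le:
  fixes g :: "'w \<Rightarrow> real"
  assumes "g \<in> borel_measurable M" "\<And>\<omega>. \<omega> \<in> space M \<Longrightarrow> \<bar>g \<omega>\<bar> \<le> B"
  shows "\<bar>integral\<^sup>L M g\<bar> \<le> B"
proof -
  have i: "integrable M g" using integrable_bounded assms .
  have "\<bar>integral\<^sup>L M g\<bar> \<le> (LINT \<omega>|M. \<bar>g \<omega>\<bar>)" by (rule integral_abs_bound)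
  also have "\<dots> \<le> (LINT \<omega>|M. B)" using i assms(2) by (intro integral_mono) auto
  finally show ?thesis by (simp add: prob_space)
qed

lemma integrable_bounded_strip:
  fixes g :: "real \<Rightarrow> 'w \<Rightarrow> real"
  assumes [measurable]: "case_prod g \<in> borel_measurable (borel \<Otimes>\<^sub>M M)"
    and bdd: "\<And>t \<omega>. \<omega> \<in> space M \<Longrightarrow> \<bar>g t \<omega>\<bar> \<le> B"
  shows "integrable (lborel \<Otimes>\<^sub>M M) (\<lambda>(t, \<omega>). indicator {0..K} t * g t \<omega>)"
proof (rule integrableI_bounded_set[where A = "{0..K} \<times> space M"])
  show "emeasure (lborel \<Otimes>\<^sub>M M) ({0..K} \<times> space M) < \<infinity>"
    by (subst emeasure_pair_measure_Times) (auto simp: emeasure_space_1 emeasure_lborel_Icc_eq)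
  show "AE p in lborel \<Otimes>\<^sub>M M. p \<in> {0..K} \<times> space M \<longrightarrow> norm (case p of (t, \<omega>) \<Rightarrow> indicator {0..K} t * g t \<omega>) \<le> B"
    using bdd by (intro AE_I2) auto
  show "AE p in lborel \<Otimes>\<^sub>M M. p \<notin> {0..K} \<times> space M \<longrightarrow> (case p of (t, \<omega>) \<Rightarrow> indicator {0..K} t * g t \<omega>) = 0"
    by (intro AE_I2) (auto simp: space_pair_measure split: split_indicator_asm)
qed measurable

lemma integrable_strip_mean:
  fixes g :: "real \<Rightarrow> 'w \<Rightarrow> real"
  assumes "case_prod g \<in> borel_measurable (borel \<Otimes>\<^sub>M M)"
    and "\<And>t \<omega>. \<omega> \<in> space M \<Longrightarrow> \<bar>g t \<omega>\<bar> \<le> B"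
  shows "integrable lborel (\<lambda>t. indicator {0..K} t * (LINT \<omega>|M. g t \<omega>))"
  using LM.integrable_fst[OF integrable_bounded_strip[OF assms, of K]] by simp

text \<open>Equality of the means of the martingale at times \<open>S\<close> and \<open>0\<close>, with the compensator written as an
  integral over the line.\<close>

lemma compensator:
  fixes b S
  defines "u \<equiv> \<lambda>\<omega> s. if 0 \<le> s \<and> ennreal s \<le> \<sigma> \<omega> \<and> s \<le> S then \<phi> (x s \<omega>) b else 0"
  assumes b: "b \<in> space F" and S: "0 \<le> S"
  shows "AE \<omega> in M. integrable lborel (u \<omega>)"
    and "integrable M (\<lambda>\<omega>. LINT s|lborel. u \<omega> s)"
    and "(LINT \<omega>|M. LINT s|lborel. u \<omega> s) = (LINT \<omega>|M. H (x S \<omega>) b) - (LINT \<omega>|M. H (x 0 \<omega>) b)"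
proof -
  have u: "indicator {0..tmin (ennreal S) (\<sigma> \<omega>)} s *\<^sub>R \<phi> (X s \<omega>) b = u \<omega> s" for \<omega> s
    using S by (cases "0 \<le> s") (auto simp: u_def le_tmin_iff stopped_def tmin_eq_left split: split_indicator)
  show "AE \<omega> in M. integrable lborel (u \<omega>)"
    using X_int[OF b S] unfolding set_integrable_def u .
  define Z where "Z t \<omega> = H (x t \<omega>) b - (LINT s:{0..tmin (ennreal t) (\<sigma> \<omega>)}|lborel. \<phi> (X s \<omega>) b)" for t \<omega>
  have "martingale M Z" using X_mart[OF b] unfolding Z_def stopped_def .
  note Z = martingale_mean[OF prob_space_axioms this S]
  have ZS: "Z S \<omega> = H (x S \<omega>) b - (LINT s|lborel. u \<omega> s)" for \<omega>
    unfolding Z_def set_lebesgue_integral_def u ..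
  have "(LINT s|lborel. indicator {0} s *\<^sub>R \<phi> (X s \<omega>) b) = 0" for \<omega>
    by (intro integral_eq_zero_AE eventually_mono[OF AE_lborel_singleton[of 0]]) (auto split: split_indicator)
  then have "Z 0 \<omega> = H (x 0 \<omega>) b" for \<omega>
    by (simp add: Z_def set_lebesgue_integral_def)
  then have Z0: "Z 0 = (\<lambda>\<omega>. H (x 0 \<omega>) b)" by auto
  have H: "integrable M (\<lambda>\<omega>. H (x S \<omega>) b)"
    using b by (intro integrable_bounded[of _ C]) (auto intro!: H_bdd x_space)
  have eq: "(\<lambda>\<omega>. LINT s|lborel. u \<omega> s) = (\<lambda>\<omega>. H (x S \<omega>) b - Z S \<omega>)"
    by (simp add: ZS)
  show "integrable M (\<lambda>\<omega>. LINT s|lborel. u \<omega> s)"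
    unfolding eq using H Z(1) by simp
  show "(LINT \<omega>|M. LINT s|lborel. u \<omega> s) = (LINT \<omega>|M. H (x S \<omega>) b) - (LINT \<omega>|M. H (x 0 \<omega>) b)"
    unfolding eq using H Z by (simp add: Z0)
qed

text \<open>The integral of \<open>f\<close> over the first time and sample point, as a function of the second pair.\<close>

definition inner_mean :: "real \<Rightarrow> real \<times> 'w \<Rightarrow> real" where
  "inner_mean K = (\<lambda>(t, \<omega>'). if 0 \<le> t \<and> t \<le> K \<and> ennreal t \<le> \<tau> \<omega>'
     then (LINT \<omega>|M. H (x (K - t) \<omega>) (y t \<omega>')) - (LINT \<omega>|M. H (x 0 \<omega>) (y t \<omega>')) else 0)"

lemma duality_integrand_sections:
  fixes K t :: real
  assumes \<omega>': "\<omega>' \<in> space M"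
  defines "f \<equiv> duality_integrand X \<sigma> Y \<tau> \<phi> K"
  shows "AE \<omega> in M. integrable lborel (\<lambda>s. f ((s, \<omega>), (t, \<omega>')))"
    and "integrable M (\<lambda>\<omega>. LINT s|lborel. f ((s, \<omega>), (t, \<omega>')))"
    and "(LINT \<omega>|M. LINT s|lborel. f ((s, \<omega>), (t, \<omega>'))) = inner_mean K (t, \<omega>')"
proof -
  have "(AE \<omega> in M. integrable lborel (\<lambda>s. f ((s, \<omega>), (t, \<omega>')))) \<and>
    integrable M (\<lambda>\<omega>. LINT s|lborel. f ((s, \<omega>), (t, \<omega>'))) \<and>
    (LINT \<omega>|M. LINT s|lborel. f ((s, \<omega>), (t, \<omega>'))) = inner_mean K (t, \<omega>')"
  proof (cases "0 \<le> t \<and> t \<le> K \<and> ennreal t \<le> \<tau> \<omega>'")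
    case True
    then have f: "f ((s, \<omega>), (t, \<omega>')) =
        (if 0 \<le> s \<and> ennreal s \<le> \<sigma> \<omega> \<and> s \<le> K - t then \<phi> (x s \<omega>) (y t \<omega>') else 0)" for s \<omega>
      by (auto simp: f_def duality_integrand_def)
    have "0 \<le> K - t" using True by simp
    from compensator[OF y_space[OF \<omega>'] this, of t] True show ?thesis
      unfolding f by (simp add: inner_mean_def)
  next
    case False
    then have f: "f ((s, \<omega>), (t, \<omega>')) = 0" for s \<omega>
      by (auto simp: f_def duality_integrand_def)
    from False show ?thesis unfolding f by (auto simp: inner_mean_def)
  qed
  then show "AE \<omega> in M. integrable lborel (\<lambda>s. f ((s, \<omega>), (t, \<omega>')))"
    and "integrable M (\<lambda>\<omega>. LINT s|lborel. f ((s, \<omega>), (t, \<omega>')))"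
    and "(LINT \<omega>|M. LINT s|lborel. f ((s, \<omega>), (t, \<omega>'))) = inner_mean K (t, \<omega>')" by auto
qed

lemma abs_mean_diff_le:
  assumes "b \<in> space F"
  shows "\<bar>(LINT \<omega>|M. H (x s \<omega>) b) - (LINT \<omega>|M. H (x s' \<omega>) b)\<bar> \<le> 2 * C"
proof -
  have "\<bar>LINT \<omega>|M. H (x r \<omega>) b\<bar> \<le> C" for r
    using assms by (intro abs_integral_le) (auto intro!: H_bdd x_space)
  from this[of s] this[of s'] show ?thesis by linarith
qed

lemma integrable_inner_mean: "integrable (lborel \<Otimes>\<^sub>M M) (inner_mean K)"
proof -
  have eq: "inner_mean K = (\<lambda>(t, \<omega>'). indicator {0..K} t * (if ennreal t \<le> \<tau> \<omega>'
     then (LINT \<omega>|M. H (x (K - t) \<omega>) (y t \<omega>')) - (LINT \<omega>|M. H (x 0 \<omega>) (y t \<omega>')) else 0))"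
    by (auto simp: inner_mean_def fun_eq_iff split: split_indicator)
  show ?thesis
    unfolding eq
  proof (rule integrable_bounded_strip[where B = "2 * \<bar>C\<bar>"])
    fix t \<omega>' assume "\<omega>' \<in> space M"
    from abs_mean_diff_le[OF y_space[OF this], of "K - t" t 0]
    show "\<bar>if ennreal t \<le> \<tau> \<omega>' then (LINT \<omega>|M. H (x (K - t) \<omega>) (y t \<omega>')) - (LINT \<omega>|M. H (x 0 \<omega>) (y t \<omega>')) else 0\<bar>
      \<le> 2 * \<bar>C\<bar>" by auto
  qed measurable
qed

text \<open>The sample points are recombined by independence at the fixed times \<open>K - t\<close>, \<open>0\<close> and \<open>t\<close>, after which
  \<open>{t \<le> \<tau>}\<close> is replaced by the complement of \<open>{\<tau> < t}\<close>.\<close>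

lemma mean_inner_mean:
  assumes t: "0 \<le> t" "t \<le> K"
  shows "(LINT \<omega>'|M. inner_mean K (t, \<omega>'))
    = (LINT \<omega>|M. H (x (K - t) \<omega>) (y t \<omega>)) - (LINT \<omega>|M. H (x 0 \<omega>) (y t \<omega>))
      - (LINT \<omega>|M. (if \<tau> \<omega> < ennreal t then H (x (K - t) \<omega>) (y t \<omega>) - H (x 0 \<omega>) (y t \<omega>) else 0))"
proof -
  let ?m = "\<lambda>s \<omega>'. if ennreal t \<le> \<tau> \<omega>' then (LINT \<omega>|M. H (x s \<omega>) (y t \<omega>')) else 0"
  let ?d = "\<lambda>s \<omega>. if ennreal t \<le> \<tau> \<omega> then H (x s \<omega>) (y t \<omega>) else 0"
  have m: "integrable M (?m s)" for s
  proof (rule integrable_bounded[where B = "\<bar>C\<bar>"])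
    fix \<omega>' assume \<omega>': "\<omega>' \<in> space M"
    have "\<bar>LINT \<omega>|M. H (x s \<omega>) (y t \<omega>')\<bar> \<le> C"
      using \<omega>' by (intro abs_integral_le) (auto intro!: H_bdd x_space y_space)
    then show "\<bar>?m s \<omega>'\<bar> \<le> \<bar>C\<bar>" by auto
  qed measurable
  have H: "\<bar>H (x s \<omega>) (y t \<omega>)\<bar> \<le> \<bar>C\<bar>" if "\<omega> \<in> space M" for s \<omega>
    using H_bdd[OF x_space[OF that] y_space[OF that], of s t] by linarith
  have iH: "integrable M (\<lambda>\<omega>. H (x s \<omega>) (y t \<omega>))" for s
    using H by (intro integrable_bounded[where B = "\<bar>C\<bar>"]) auto
  have id: "integrable M (?d s)" for s
    using H by (intro integrable_bounded[where B = "\<bar>C\<bar>"]) auto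
  have md: "integral\<^sup>L M (?m s) = integral\<^sup>L M (?d s)" if "0 \<le> s" for s
    by (rule decoupled_integral[OF that t(1) H_meas H_bdd, where j = "\<lambda>r. ennreal t \<le> r", symmetric]) auto
  have "(LINT \<omega>'|M. inner_mean K (t, \<omega>')) = (LINT \<omega>'|M. ?m (K - t) \<omega>' - ?m 0 \<omega>')"
    using t by (intro Bochner_Integration.integral_cong) (auto simp: inner_mean_def)
  also have "\<dots> = integral\<^sup>L M (?d (K - t)) - integral\<^sup>L M (?d 0)"
    using m md[of "K - t"] md[of 0] t by simp
  also have "\<dots> = (LINT \<omega>|M. ?d (K - t) \<omega> - ?d 0 \<omega>)"
    using id by simp
  also have "\<dots> = (LINT \<omega>|M. H (x (K - t) \<omega>) (y t \<omega>) - H (x 0 \<omega>) (y t \<omega>)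
      - (if \<tau> \<omega> < ennreal t then H (x (K - t) \<omega>) (y t \<omega>) - H (x 0 \<omega>) (y t \<omega>) else 0))"
    by (intro Bochner_Integration.integral_cong) auto
  also have "\<dots> = (LINT \<omega>|M. H (x (K - t) \<omega>) (y t \<omega>) - H (x 0 \<omega>) (y t \<omega>))
      - (LINT \<omega>|M. (if \<tau> \<omega> < ennreal t then H (x (K - t) \<omega>) (y t \<omega>) - H (x 0 \<omega>) (y t \<omega>) else 0))"
  proof (intro Bochner_Integration.integral_diff integrable_bounded[where B = "2 * \<bar>C\<bar>"])
    fix \<omega> assume "\<omega> \<in> space M"
    from H[OF this, of "K - t"] H[OF this, of 0]
    show "\<bar>H (x (K - t) \<omega>) (y t \<omega>) - H (x 0 \<omega>) (y t \<omega>)\<bar> \<le> 2 * \<bar>C\<bar>"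
      and "\<bar>if \<tau> \<omega> < ennreal t then H (x (K - t) \<omega>) (y t \<omega>) - H (x 0 \<omega>) (y t \<omega>) else 0\<bar> \<le> 2 * \<bar>C\<bar>"
      by auto
  qed measurable
  finally show ?thesis using iH by simp
qed

lemma measurable_shifted_increment [measurable]:
  "case_prod (shifted_increment X \<sigma> Y \<tau> H) \<in> borel_measurable (borel \<Otimes>\<^sub>M M)"
  unfolding shifted_increment_def case_prod_beta' by measurable

lemma shifted_increment_bdd:
  assumes \<omega>: "\<omega> \<in> space M"
  shows "\<bar>shifted_increment X \<sigma> Y \<tau> H t \<omega>\<bar> \<le> 2 * \<bar>C\<bar>"
  using H_bdd[OF x_space[OF \<omega>, of "t - enn2real (\<tau> \<omega>)"] Y_\<tau>_space[OF \<omega>]] H_bdd[OF x_space[OF \<omega>, of 0] Y_\<tau>_space[OF \<omega>]]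
  by (auto simp: shifted_increment_def)

text \<open>On \<open>{\<tau> < t}\<close> the process \<open>y\<^sub>t\<close> has already reached \<open>Y\<^sub>\<tau>\<close>, and \<open>t \<mapsto> K + \<tau> - t\<close> maps \<open>{\<tau> < t \<le> K}\<close> onto
  \<open>{\<tau> \<le> t < K}\<close>. After this substitution the integrands differ at most at the point \<open>t = K\<close>. The identity holds for
  each sample point separately and needs no independence.\<close>

lemma reflected_increment:
  assumes \<omega>: "\<omega> \<in> space M" and K: "0 \<le> K"
  shows "(LINT t|lborel. indicator {0..K} t *
      (if \<tau> \<omega> < ennreal t then H (x (K - t) \<omega>) (y t \<omega>) - H (x 0 \<omega>) (y t \<omega>) else 0))
    = (LINT t|lborel. indicator {0..K} t * shifted_increment X \<sigma> Y \<tau> H t \<omega>)"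
proof (cases "\<tau> \<omega>")
  case top
  then show ?thesis by (simp add: shifted_increment_def top_unique)
next
  case (real r)
  let ?g = "\<lambda>t. indicator {0..K} t *
      (if \<tau> \<omega> < ennreal t then H (x (K - t) \<omega>) (y t \<omega>) - H (x 0 \<omega>) (y t \<omega>) else 0)"
  note [simp] = \<omega>
  have "(LINT t|lborel. ?g t) = (LINT t|lborel. ?g ((K + r) + (-1) * t))"
    by (subst lborel_integral_real_affine[where c = "-1" and t = "K + r"]) auto
  also have "\<dots> = (LINT t|lborel. indicator {0..K} t * shifted_increment X \<sigma> Y \<tau> H t \<omega>)"
  proof (rule integral_cong_AE)
    show "AE t in lborel. ?g ((K + r) + (-1) * t) = indicator {0..K} t * shifted_increment X \<sigma> Y \<tau> H t \<omega>"
      using AE_lborel_singleton[of K]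
    proof eventually_elim
      fix t assume "t \<noteq> K"
      show "?g ((K + r) + (-1) * t) = indicator {0..K} t * shifted_increment X \<sigma> Y \<tau> H t \<omega>"
      proof (cases "r \<le> t \<and> t < K")
        case True
        then have "y ((K + r) + (-1) * t) \<omega> = Y r \<omega>"
          using real by (simp add: stopped_def tmin_eq_right)
        with True real show ?thesis
          by (auto simp: shifted_increment_def ennreal_less_iff algebra_simps split: split_indicator)
      next
        case False
        with \<open>t \<noteq> K\<close> real show ?thesis
          by (auto simp: shifted_increment_def ennreal_less_iff ennreal_le_iff2 split: split_indicator)
      qed
    qed
  qed measurable
  finally show ?thesis .
qed

lemma integral_duality_integrand:
  assumes K: "0 \<le> K"
    and fin: "(\<integral>\<^sup>+z. ennreal (duality_integrand X \<sigma> Y \<tau> \<phi> K z) \<partial>((lborel \<Otimes>\<^sub>M M) \<Otimes>\<^sub>M (lborel \<Otimes>\<^sub>M M))) < \<infinity> \<or>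
      (\<integral>\<^sup>+z. ennreal (- duality_integrand X \<sigma> Y \<tau> \<phi> K z) \<partial>((lborel \<Otimes>\<^sub>M M) \<Otimes>\<^sub>M (lborel \<Otimes>\<^sub>M M))) < \<infinity>"
  shows "integral\<^sup>L ((lborel \<Otimes>\<^sub>M M) \<Otimes>\<^sub>M (lborel \<Otimes>\<^sub>M M)) (duality_integrand X \<sigma> Y \<tau> \<phi> K)
    = (LINT t|lborel. indicator {0..K} t * (LINT \<omega>|M. H (x (K - t) \<omega>) (y t \<omega>)))
      - (LINT t|lborel. indicator {0..K} t * (LINT \<omega>|M. H (x 0 \<omega>) (y t \<omega>)))
      - (LINT t|lborel. indicator {0..K} t * (LINT \<omega>|M. shifted_increment X \<sigma> Y \<tau> H t \<omega>))"
proof -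
  let ?f = "duality_integrand X \<sigma> Y \<tau> \<phi> K"
  let ?d = "\<lambda>t \<omega>. if \<tau> \<omega> < ennreal t then H (x (K - t) \<omega>) (y t \<omega>) - H (x 0 \<omega>) (y t \<omega>) else 0"
  have H: "\<bar>H (x s \<omega>) (y t \<omega>)\<bar> \<le> \<bar>C\<bar>" if "\<omega> \<in> space M" for s t \<omega>
    using H_bdd[OF x_space[OF that] y_space[OF that], of s t] by linarith
  have d: "\<bar>?d t \<omega>\<bar> \<le> 2 * \<bar>C\<bar>" if "\<omega> \<in> space M" for t \<omega>
    using H[OF that, of "K - t" t] H[OF that, of 0 t] by auto
  have i1: "integrable lborel (\<lambda>t. indicator {0..K} t * (LINT \<omega>|M. H (x (K - t) \<omega>) (y t \<omega>)))"
    and i2: "integrable lborel (\<lambda>t. indicator {0..K} t * (LINT \<omega>|M. H (x 0 \<omega>) (y t \<omega>)))"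
    by (rule integrable_strip_mean[OF _ H]; measurable)+
  have i3: "integrable lborel (\<lambda>t. indicator {0..K} t * (LINT \<omega>|M. ?d t \<omega>))"
    by (rule integrable_strip_mean[OF _ d]) measurable
  have e: "(LINT \<omega>|M. LINT s|lborel. ?f ((s, \<omega>), q)) = inner_mean K q" if "q \<in> space (lborel \<Otimes>\<^sub>M M)" for q
    using that duality_integrand_sections(3)[of "snd q" K "fst q"] by (auto simp: space_pair_measure)
  have "integral\<^sup>L ((lborel \<Otimes>\<^sub>M M) \<Otimes>\<^sub>M (lborel \<Otimes>\<^sub>M M)) ?f
      = (LINT q|(lborel \<Otimes>\<^sub>M M). LINT \<omega>|M. LINT s|lborel. ?f ((s, \<omega>), q))"
  proof (rule Fubini_one_sided)
    show "integrable (lborel \<Otimes>\<^sub>M M) (\<lambda>q. LINT \<omega>|M. LINT s|lborel. ?f ((s, \<omega>), q))"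
      using integrable_inner_mean by (subst Bochner_Integration.integrable_cong[OF refl e]) auto
  qed (use fin duality_integrand_sections in
      \<open>auto simp: space_pair_measure intro: measurable_duality_integrand[OF \<phi>_meas] sigma_finite_lborel
         sigma_finite_measure_axioms LM.P.sigma_finite_measure_axioms\<close>)
  also have "\<dots> = (LINT q|(lborel \<Otimes>\<^sub>M M). inner_mean K q)"
    by (intro Bochner_Integration.integral_cong e) auto
  also have "\<dots> = (LINT t|lborel. LINT \<omega>'|M. inner_mean K (t, \<omega>'))"
    using LM.integral_fst'[OF integrable_inner_mean] by simp
  also have "\<dots> = (LINT t|lborel. indicator {0..K} t * (LINT \<omega>|M. H (x (K - t) \<omega>) (y t \<omega>))
     - indicator {0..K} t * (LINT \<omega>|M. H (x 0 \<omega>) (y t \<omega>)) - indicator {0..K} t * (LINT \<omega>|M. ?d t \<omega>))"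
    using mean_inner_mean
    by (intro Bochner_Integration.integral_cong) (auto simp: inner_mean_def split: split_indicator)
  also have "\<dots> = (LINT t|lborel. indicator {0..K} t * (LINT \<omega>|M. H (x (K - t) \<omega>) (y t \<omega>)))
     - (LINT t|lborel. indicator {0..K} t * (LINT \<omega>|M. H (x 0 \<omega>) (y t \<omega>)))
     - (LINT t|lborel. indicator {0..K} t * (LINT \<omega>|M. ?d t \<omega>))"
    by (simp only: Bochner_Integration.integral_diff Bochner_Integration.integrable_diff i1 i2 i3)
  also have "(LINT t|lborel. indicator {0..K} t * (LINT \<omega>|M. ?d t \<omega>))
     = (LINT t|lborel. LINT \<omega>|M. indicator {0..K} t * ?d t \<omega>)"
    by simp
  also have "\<dots> = (LINT \<omega>|M. LINT t|lborel. indicator {0..K} t * ?d t \<omega>)"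
    by (rule LM.Fubini_integral[symmetric], rule integrable_bounded_strip[OF _ d]) measurable
  also have "\<dots> = (LINT \<omega>|M. LINT t|lborel. indicator {0..K} t * shifted_increment X \<sigma> Y \<tau> H t \<omega>)"
    by (intro Bochner_Integration.integral_cong reflected_increment K) auto
  also have "\<dots> = (LINT t|lborel. LINT \<omega>|M. indicator {0..K} t * shifted_increment X \<sigma> Y \<tau> H t \<omega>)"
    by (rule LM.Fubini_integral, rule integrable_bounded_strip[OF _ shifted_increment_bdd]) measurable
  finally show ?thesis by simp
qed

end

section \<open>The duality identity\<close>

lemma shifted_increment_eq:
  assumes "0 \<le> t"
  shows "shifted_increment X \<sigma> Y \<tau> H t \<omega> =
    (H (X (tmin (ennreal t - \<tau> \<omega>) (\<sigma> \<omega>)) \<omega>) (Y (enn2real (\<tau> \<omega>)) \<omega>)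
      - H (X 0 \<omega>) (Y (enn2real (\<tau> \<omega>)) \<omega>)) * indicator {\<omega>. \<tau> \<omega> \<le> ennreal t} \<omega>"
proof (cases "\<tau> \<omega>")
  case (real r)
  with assms show ?thesis
    by (auto simp: shifted_increment_def stopped_def ennreal_minus split: split_indicator)
qed (simp add: shifted_increment_def top_unique)

theorem theorem5:
  fixes M :: "'w measure" and E :: "'e measure" and F :: "'f measure"
    and X :: "real \<Rightarrow> 'w \<Rightarrow> 'e" and \<sigma> :: "'w \<Rightarrow> ennreal"
    and Y :: "real \<Rightarrow> 'w \<Rightarrow> 'f" and \<tau> :: "'w \<Rightarrow> ennreal"
    and H \<phi> :: "'e \<Rightarrow> 'f \<Rightarrow> real"
  assumes M: "prob_space M"
    and X: "measurable_process M E X" and \<sigma>: "\<sigma> \<in> borel_measurable M"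
    and Y: "measurable_process M F Y" and \<tau>: "\<tau> \<in> borel_measurable M"
    and indep: "indep_elements M (path_space E) (path_with_time X \<sigma>)
                  (path_space F) (path_with_time Y \<tau>)"
    and H_meas: "(\<lambda>(x, y). H x y) \<in> borel_measurable (E \<Otimes>\<^sub>M F)"
    and H_bdd: "\<exists>C. \<forall>x\<in>space E. \<forall>y\<in>space F. \<bar>H x y\<bar> \<le> C"
    and \<phi>_meas: "(\<lambda>(x, y). \<phi> x y) \<in> borel_measurable (E \<Otimes>\<^sub>M F)"
    and \<phi>_sign:
      "(\<forall>T\<ge>0. (\<integral>\<^sup>+t\<in>{0..T}. (\<integral>\<^sup>+s\<in>{0..T}.
           (\<integral>\<^sup>+\<omega>. ennreal (max (\<phi> (X (tmin (ennreal s) (\<sigma> \<omega>)) \<omega>) (Y (tmin (ennreal t) (\<tau> \<omega>)) \<omega>)) 0) \<partial>M)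
             * indicator {0..T} (s + t) \<partial>lborel) \<partial>lborel) < \<infinity>) \<or>
       (\<forall>T\<ge>0. (\<integral>\<^sup>+t\<in>{0..T}. (\<integral>\<^sup>+s\<in>{0..T}.
           (\<integral>\<^sup>+\<omega>. ennreal (max (- \<phi> (X (tmin (ennreal s) (\<sigma> \<omega>)) \<omega>) (Y (tmin (ennreal t) (\<tau> \<omega>)) \<omega>)) 0) \<partial>M)
             * indicator {0..T} (s + t) \<partial>lborel) \<partial>lborel) < \<infinity>)"
    and \<phi>_stopped:
      "AE t in lborel. 0 \<le> t \<longrightarrow>
         (\<integral>\<^sup>+\<omega>. ennreal \<bar>\<phi> (X (enn2real (\<sigma> \<omega>)) \<omega>) (Y (enn2real (\<tau> \<omega>)) \<omega>)\<bar>
            * indicator {\<omega>. \<sigma> \<omega> + \<tau> \<omega> \<le> ennreal t} \<omega> \<partial>M) < \<infinity>"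
    and X_int: "\<And>y t. y \<in> space F \<Longrightarrow> 0 \<le> t \<Longrightarrow>
         AE \<omega> in M. set_integrable lborel {0..tmin (ennreal t) (\<sigma> \<omega>)} (\<lambda>s. \<phi> (X s \<omega>) y)"
    and X_mart: "\<And>y. y \<in> space F \<Longrightarrow>
         martingale M (\<lambda>t \<omega>. H (X (tmin (ennreal t) (\<sigma> \<omega>)) \<omega>) y
           - (LINT s:{0..tmin (ennreal t) (\<sigma> \<omega>)}|lborel. \<phi> (X s \<omega>) y))"
    and Y_int: "\<And>x t. x \<in> space E \<Longrightarrow> 0 \<le> t \<Longrightarrow>
         AE \<omega> in M. set_integrable lborel {0..tmin (ennreal t) (\<tau> \<omega>)} (\<lambda>s. \<phi> x (Y s \<omega>))"
    and Y_mart: "\<And>x. x \<in> space E \<Longrightarrow>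
         martingale M (\<lambda>t \<omega>. H x (Y (tmin (ennreal t) (\<tau> \<omega>)) \<omega>)
           - (LINT s:{0..tmin (ennreal t) (\<tau> \<omega>)}|lborel. \<phi> x (Y s \<omega>)))"
  shows
    "(AE t in lborel. 0 \<le> t \<longrightarrow>
       (let A = (\<lambda>\<omega>. H (X (tmin (ennreal t) (\<sigma> \<omega>)) \<omega>) (Y 0 \<omega>));
            B = (\<lambda>\<omega>. H (X 0 \<omega>) (Y (tmin (ennreal t) (\<tau> \<omega>)) \<omega>));
            C = (\<lambda>\<omega>. (H (X (tmin (ennreal t - \<tau> \<omega>) (\<sigma> \<omega>)) \<omega>) (Y (enn2real (\<tau> \<omega>)) \<omega>)
                      - H (X 0 \<omega>) (Y (enn2real (\<tau> \<omega>)) \<omega>))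
                     * indicator {\<omega>. \<tau> \<omega> \<le> ennreal t} \<omega>);
            D = (\<lambda>\<omega>. (H (X (enn2real (\<sigma> \<omega>)) \<omega>) (Y (tmin (ennreal t - \<sigma> \<omega>) (\<tau> \<omega>)) \<omega>)
                      - H (X (enn2real (\<sigma> \<omega>)) \<omega>) (Y 0 \<omega>))
                     * indicator {\<omega>. \<sigma> \<omega> \<le> ennreal t} \<omega>);
            G = (\<lambda>\<omega>. \<phi> (X (enn2real (\<sigma> \<omega>)) \<omega>) (Y (enn2real (\<tau> \<omega>)) \<omega>)
                     * (enn2real ((ennreal t - \<tau> \<omega>) - \<sigma> \<omega>)
                        - enn2real ((ennreal t - \<sigma> \<omega>) - \<tau> \<omega>)))
        in integrable M A \<and> integrable M B \<and> integrable M C \<and> integrable M D \<and> integrable M G \<and>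
           (LINT \<omega>|M. A \<omega>) - (LINT \<omega>|M. B \<omega>)
             = (LINT \<omega>|M. C \<omega>) - (LINT \<omega>|M. D \<omega>) + (LINT \<omega>|M. G \<omega>))) \<and>
     ((\<forall>\<omega>\<in>space M. \<sigma> \<omega> = \<infinity> \<and> \<tau> \<omega> = \<infinity>) \<longrightarrow>
       (AE t in lborel. 0 \<le> t \<longrightarrow>
          integrable M (\<lambda>\<omega>. H (X t \<omega>) (Y 0 \<omega>)) \<and> integrable M (\<lambda>\<omega>. H (X 0 \<omega>) (Y t \<omega>)) \<and>
          (LINT \<omega>|M. H (X t \<omega>) (Y 0 \<omega>)) = (LINT \<omega>|M. H (X 0 \<omega>) (Y t \<omega>))))"
proof -
  interpret prob_space M by (rule M)
  obtain C where C: "\<And>a b. a \<in> space E \<Longrightarrow> b \<in> space F \<Longrightarrow> \<bar>H a b\<bar> \<le> C"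
    using H_bdd by blast
  interpret XY: independent_with_martingale M E F X \<sigma> Y \<tau> H \<phi> C
    by unfold_locales (use X \<sigma> Y \<tau> indep H_meas C \<phi>_meas X_int X_mart in simp_all)
  interpret YX: independent_with_martingale M F E Y \<tau> X \<sigma> "\<lambda>b a. H a b" "\<lambda>b a. \<phi> a b" C
    using measurable_pair_swap[OF H_meas] measurable_pair_swap[OF \<phi>_meas]
    by unfold_locales (use X \<sigma> Y \<tau> indep_elements_sym[OF M indep] C Y_int Y_mart in \<open>simp_all add: case_prod_beta'\<close>)
  let ?P = "lborel \<Otimes>\<^sub>M M"
  let ?f = "\<lambda>K. duality_integrand X \<sigma> Y \<tau> \<phi> K"
  let ?f' = "\<lambda>K. duality_integrand Y \<tau> X \<sigma> (\<lambda>b a. \<phi> a b) K"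
  note mf [measurable] = XY.measurable_duality_integrand[OF XY.\<phi>_meas]
  have fin: "(\<integral>\<^sup>+z. ennreal (?f K z) \<partial>(?P \<Otimes>\<^sub>M ?P)) < \<infinity> \<or> (\<integral>\<^sup>+z. ennreal (- ?f K z) \<partial>(?P \<Otimes>\<^sub>M ?P)) < \<infinity>"
    if K: "0 \<le> K" for K
  proof -
    have neg: "- ?f K z = duality_integrand X \<sigma> Y \<tau> (\<lambda>a b. - \<phi> a b) K z" for z
      by (auto simp: duality_integrand_def split: prod.split)
    have m: "case_prod (\<lambda>a b. - \<phi> a b) \<in> borel_measurable (E \<Otimes>\<^sub>M F)"
      by (simp add: case_prod_beta')
    from \<phi>_sign show ?thesis
    proof
      assume a: "\<forall>T\<ge>0. (\<integral>\<^sup>+t\<in>{0..T}. (\<integral>\<^sup>+s\<in>{0..T}.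
           (\<integral>\<^sup>+\<omega>. ennreal (max (\<phi> (X (tmin (ennreal s) (\<sigma> \<omega>)) \<omega>) (Y (tmin (ennreal t) (\<tau> \<omega>)) \<omega>)) 0) \<partial>M)
             * indicator {0..T} (s + t) \<partial>lborel) \<partial>lborel) < \<infinity>"
      show ?thesis
        by (intro disjI1 XY.duality_integrand_one_sided_integrable[OF XY.\<phi>_meas])
           (use a K in \<open>simp add: stopped_def ennreal_max_0'\<close>)
    next
      assume a: "\<forall>T\<ge>0. (\<integral>\<^sup>+t\<in>{0..T}. (\<integral>\<^sup>+s\<in>{0..T}.
           (\<integral>\<^sup>+\<omega>. ennreal (max (- \<phi> (X (tmin (ennreal s) (\<sigma> \<omega>)) \<omega>) (Y (tmin (ennreal t) (\<tau> \<omega>)) \<omega>)) 0) \<partial>M)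
             * indicator {0..T} (s + t) \<partial>lborel) \<partial>lborel) < \<infinity>"
      show ?thesis unfolding neg
        by (intro disjI2 XY.duality_integrand_one_sided_integrable[OF m])
           (use a K in \<open>simp add: stopped_def ennreal_max_0'\<close>)
    qed
  qed
  have swap: "(\<integral>\<^sup>+z. g (case z of (q, p) \<Rightarrow> (p, q)) \<partial>(?P \<Otimes>\<^sub>M ?P)) = (\<integral>\<^sup>+z. g z \<partial>(?P \<Otimes>\<^sub>M ?P))"
    if [measurable]: "g \<in> borel_measurable (?P \<Otimes>\<^sub>M ?P)" for g
  proof -
    have "(\<integral>\<^sup>+z. g (case z of (q, p) \<Rightarrow> (p, q)) \<partial>(?P \<Otimes>\<^sub>M ?P)) = (\<integral>\<^sup>+q. \<integral>\<^sup>+p. g (p, q) \<partial>?P \<partial>?P)"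
      by (subst XY.LM.P.nn_integral_fst[symmetric]) auto
    also have "\<dots> = (\<integral>\<^sup>+z. g z \<partial>(?P \<Otimes>\<^sub>M ?P))"
      by (rule XY.LMLM.nn_integral_snd) fact
    finally show ?thesis .
  qed
  have f': "?f' K = (\<lambda>z. ?f K (case z of (q, p) \<Rightarrow> (p, q)))" for K
    by (subst duality_integrand_swap) auto
  have fin': "(\<integral>\<^sup>+z. ennreal (?f' K z) \<partial>(?P \<Otimes>\<^sub>M ?P)) < \<infinity> \<or> (\<integral>\<^sup>+z. ennreal (- ?f' K z) \<partial>(?P \<Otimes>\<^sub>M ?P)) < \<infinity>"
    if "0 \<le> K" for K
    using fin[OF that] swap[of "\<lambda>z. ennreal (?f K z)"] swap[of "\<lambda>z. ennreal (- ?f K z)"] unfolding f' by simp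
  have swap_int: "integral\<^sup>L (?P \<Otimes>\<^sub>M ?P) (?f' K) = integral\<^sup>L (?P \<Otimes>\<^sub>M ?P) (?f K)" for K
    by (subst duality_integrand_swap) (rule XY.LMLM.integral_product_swap[OF mf])

  let ?m = "\<lambda>s t. LINT \<omega>|M. H (stopped X \<sigma> s \<omega>) (stopped Y \<tau> t \<omega>)"
  let ?cX = "\<lambda>t. LINT \<omega>|M. shifted_increment X \<sigma> Y \<tau> H t \<omega>"
  let ?cY = "\<lambda>t. LINT \<omega>|M. shifted_increment Y \<tau> X \<sigma> (\<lambda>b a. H a b) t \<omega>"
  have H_le: "\<bar>H (stopped X \<sigma> s \<omega>) (stopped Y \<tau> t \<omega>)\<bar> \<le> C" if "\<omega> \<in> space M" for s t \<omega>
    using that by (intro C XY.x_space XY.y_space)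
  have i1: "integrable lborel (\<lambda>t. indicator {0..K} t * ?m t 0)" for K
    by (rule XY.integrable_strip_mean[OF _ H_le]) measurable
  have i2: "integrable lborel (\<lambda>t. indicator {0..K} t * ?m 0 t)" for K
    by (rule XY.integrable_strip_mean[OF _ H_le]) measurable
  have i3: "integrable lborel (\<lambda>t. indicator {0..K} t * ?cX t)" for K
    by (rule XY.integrable_strip_mean[OF _ XY.shifted_increment_bdd]) measurable
  have i4: "integrable lborel (\<lambda>t. indicator {0..K} t * ?cY t)" for K
    by (rule YX.integrable_strip_mean[OF _ YX.shifted_increment_bdd]) measurable
  \<comment> \<open>The two integrals of the mean along the antidiagonal, one from each order of integration.\<close>
  have reflect: "(LINT t|lborel. indicator {0..K} t * ?m (K - t) t) = (LINT t|lborel. indicator {0..K} t * ?m t (K - t))" for K :: real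
    by (subst lborel_integral_real_affine[where c = "-1" and t = K])
       (auto intro!: Bochner_Integration.integral_cong split: split_indicator)
  have "AE t in lborel. 0 \<le> t \<longrightarrow> ?m t 0 - ?m 0 t - ?cX t + ?cY t = 0"
  proof (rule AE_zero_if_Icc_integrals_zero)
    fix K :: real assume K: "0 \<le> K"
    have eq: "indicator {0..K} t * (?m t 0 - ?m 0 t - ?cX t + ?cY t) =
        indicator {0..K} t * ?m t 0 - indicator {0..K} t * ?m 0 t - indicator {0..K} t * ?cX t + indicator {0..K} t * ?cY t" for t
      by (simp add: algebra_simps)
    show "integrable lborel (\<lambda>t. indicator {0..K} t * (?m t 0 - ?m 0 t - ?cX t + ?cY t))"
      unfolding eq by (intro Bochner_Integration.integrable_add Bochner_Integration.integrable_diff i1 i2 i3 i4)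
    have "(LINT t|lborel. indicator {0..K} t * (?m t 0 - ?m 0 t - ?cX t + ?cY t)) =
      (LINT t|lborel. indicator {0..K} t * ?m t 0) - (LINT t|lborel. indicator {0..K} t * ?m 0 t)
      - (LINT t|lborel. indicator {0..K} t * ?cX t) + (LINT t|lborel. indicator {0..K} t * ?cY t)"
      unfolding eq by (simp only: Bochner_Integration.integral_add Bochner_Integration.integral_diff
        Bochner_Integration.integrable_diff i1 i2 i3 i4)
    also have "\<dots> = 0"
      using XY.integral_duality_integrand[OF K fin[OF K]] YX.integral_duality_integrand[OF K fin'[OF K]]
        reflect[of K] swap_int[of K] by linarith
    finally show "(LINT t|lborel. indicator {0..K} t * (?m t 0 - ?m 0 t - ?cX t + ?cY t)) = 0" .
  qed
  then have star: "AE t in lborel. 0 \<le> t \<longrightarrow> ?m t 0 - ?m 0 t = ?cX t - ?cY t"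
    by eventually_elim auto

  have int_H: "integrable M (\<lambda>\<omega>. H (stopped X \<sigma> s \<omega>) (stopped Y \<tau> t \<omega>))" for s t
    by (rule XY.integrable_bounded[OF _ H_le]) measurable
  have int_cX: "integrable M (shifted_increment X \<sigma> Y \<tau> H t)" for t
    by (rule XY.integrable_bounded[OF _ XY.shifted_increment_bdd]) measurable
  have int_cY: "integrable M (shifted_increment Y \<tau> X \<sigma> (\<lambda>b a. H a b) t)" for t
    by (rule YX.integrable_bounded[OF _ YX.shifted_increment_bdd]) measurable
  \<comment> \<open>Truncated subtractions commute, so the coefficient of \<open>\<phi>(X\<^sub>\<sigma>, Y\<^sub>\<tau>)\<close> vanishes.\<close>
  have G: "enn2real ((ennreal t - \<tau> \<omega>) - \<sigma> \<omega>) - enn2real ((ennreal t - \<sigma> \<omega>) - \<tau> \<omega>) = 0" for t \<omega>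
    by (subst diff_diff_commute_ennreal) simp
  have stopped_0: "stopped Z \<rho> 0 = Z 0" for Z :: "real \<Rightarrow> 'w \<Rightarrow> 'z" and \<rho>
    by (simp add: stopped_def fun_eq_iff)
  show ?thesis
  proof (intro conjI impI)
    show "AE t in lborel. 0 \<le> t \<longrightarrow>
       (let A = (\<lambda>\<omega>. H (X (tmin (ennreal t) (\<sigma> \<omega>)) \<omega>) (Y 0 \<omega>));
            B = (\<lambda>\<omega>. H (X 0 \<omega>) (Y (tmin (ennreal t) (\<tau> \<omega>)) \<omega>));
            C = (\<lambda>\<omega>. (H (X (tmin (ennreal t - \<tau> \<omega>) (\<sigma> \<omega>)) \<omega>) (Y (enn2real (\<tau> \<omega>)) \<omega>)
                      - H (X 0 \<omega>) (Y (enn2real (\<tau> \<omega>)) \<omega>))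
                     * indicator {\<omega>. \<tau> \<omega> \<le> ennreal t} \<omega>);
            D = (\<lambda>\<omega>. (H (X (enn2real (\<sigma> \<omega>)) \<omega>) (Y (tmin (ennreal t - \<sigma> \<omega>) (\<tau> \<omega>)) \<omega>)
                      - H (X (enn2real (\<sigma> \<omega>)) \<omega>) (Y 0 \<omega>))
                     * indicator {\<omega>. \<sigma> \<omega> \<le> ennreal t} \<omega>);
            G = (\<lambda>\<omega>. \<phi> (X (enn2real (\<sigma> \<omega>)) \<omega>) (Y (enn2real (\<tau> \<omega>)) \<omega>)
                     * (enn2real ((ennreal t - \<tau> \<omega>) - \<sigma> \<omega>)
                        - enn2real ((ennreal t - \<sigma> \<omega>) - \<tau> \<omega>)))
        in integrable M A \<and> integrable M B \<and> integrable M C \<and> integrable M D \<and> integrable M G \<and>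
           (LINT \<omega>|M. A \<omega>) - (LINT \<omega>|M. B \<omega>)
             = (LINT \<omega>|M. C \<omega>) - (LINT \<omega>|M. D \<omega>) + (LINT \<omega>|M. G \<omega>))"
      (is "AE t in lborel. _ \<longrightarrow> ?identity t")
      using star
    proof (eventually_elim, intro impI)
      fix t :: real
      assume "0 \<le> t \<longrightarrow> ?m t 0 - ?m 0 t = ?cX t - ?cY t" and t: "0 \<le> t"
      then show "?identity t"
        using int_H[of t 0] int_H[of 0 t] int_cX[of t] int_cY[of t]
        unfolding Let_def G shifted_increment_eq[OF t, abs_def] stopped_0
        unfolding stopped_def by simp
    qed
    assume inf: "\<forall>\<omega>\<in>space M. \<sigma> \<omega> = \<infinity> \<and> \<tau> \<omega> = \<infinity>"
    show "AE t in lborel. 0 \<le> t \<longrightarrow>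
          integrable M (\<lambda>\<omega>. H (X t \<omega>) (Y 0 \<omega>)) \<and> integrable M (\<lambda>\<omega>. H (X 0 \<omega>) (Y t \<omega>)) \<and>
          (LINT \<omega>|M. H (X t \<omega>) (Y 0 \<omega>)) = (LINT \<omega>|M. H (X 0 \<omega>) (Y t \<omega>))"
      using star
    proof (eventually_elim, intro impI)
      fix t :: real
      assume eq: "0 \<le> t \<longrightarrow> ?m t 0 - ?m 0 t = ?cX t - ?cY t" and t: "0 \<le> t"
      have "?cX t = (LINT \<omega>|M. 0)" "?cY t = (LINT \<omega>|M. 0)"
        by (intro Bochner_Integration.integral_cong; simp add: shifted_increment_def inf top_unique)+
      moreover have "H (stopped X \<sigma> t \<omega>) (stopped Y \<tau> 0 \<omega>) = H (X t \<omega>) (Y 0 \<omega>)"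
          "H (stopped X \<sigma> 0 \<omega>) (stopped Y \<tau> t \<omega>) = H (X 0 \<omega>) (Y t \<omega>)" if "\<omega> \<in> space M" for \<omega>
        using inf that t by (simp_all add: stopped_def tmin_eq_left)
      then have "integrable M (\<lambda>\<omega>. H (X t \<omega>) (Y 0 \<omega>))" "integrable M (\<lambda>\<omega>. H (X 0 \<omega>) (Y t \<omega>))"
          "?m t 0 = (LINT \<omega>|M. H (X t \<omega>) (Y 0 \<omega>))" "?m 0 t = (LINT \<omega>|M. H (X 0 \<omega>) (Y t \<omega>))"
        using int_H[of t 0] int_H[of 0 t]
        by (simp_all cong: Bochner_Integration.integrable_cong Bochner_Integration.integral_cong)
      ultimately show "integrable M (\<lambda>\<omega>. H (X t \<omega>) (Y 0 \<omega>)) \<and> integrable M (\<lambda>\<omega>. H (X 0 \<omega>) (Y t \<omega>)) \<and>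
          (LINT \<omega>|M. H (X t \<omega>) (Y 0 \<omega>)) = (LINT \<omega>|M. H (X 0 \<omega>) (Y t \<omega>))"
        using eq t by simp
    qed
  qed
qed

end
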